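(* Fix $0<t<\frac{1}{3\sqrt5}$ and $H>0$. Let $P_1,P_2\subset\mathbb{R}^2$ be the plane convex bodies with support functions $$h_1(\theta)=1+t\cos2\theta,\qquad h_2(\theta)=1+\frac{t}{\sqrt5}\cos4\theta,$$ and let $K_j=P_j\times[-H/2,H/2]\subset\mathbb{R}^3$, $j=1,2$ (these are centrally symmetric convex bodies). Put $A=\pi\left(1-\frac32t^2\right)$. Then, for $j=1,2$, $$V_3(K_j)=AH,\qquad V_2(K_j)=A+\pi H,\qquad V_1(K_j)=\pi+H,$$ and hence $K_1$ and $K_2$ have identical intrinsic volumes. Nevertheless, with $U$ uniformly distributed on $S^2$, $W_K=w_K(U)$ and $B_K=b_K(U)$, $$\mathbb{E}W_{K_1}^2-\mathbb{E}W_{K_2}^2=\frac{16}{15}t^2>0,\qquad\mathbb{E}B_{K_1}^2-\mathbb{E}B_{K_2}^2=\frac{16}{15}H^2t^2>0.$$ In particular, within the class of centrally symmetric convex bodies in $\mathbb{R}^3$, neither the random-direction width law (the law of $W_K$) nor the random-direction brightness law (the law of $B_K$) is determined by $V_1,V_2,V_3$.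
   Context: The support function of a plane body is written as a function of the angle $\theta$ of the direction $(\cos\theta,\sin\theta)$. For a compact convex body $K\subset\mathbb{R}^3$ and $u\in S^2$: the width is $w_K(u)=\max_{x\in K}u\cdot x-\min_{x\in K}u\cdot x$ and the brightness $b_K(u)$ is the area of the orthogonal projection of $K$ onto $u^{\perp}$. The intrinsic volumes $V_0=1,V_1,V_2,V_3$ are normalized by the Steiner formula $\operatorname{Vol}_3(K+\rho B^3)=V_3(K)+2\rho V_2(K)+\pi\rho^2V_1(K)+\frac{4\pi}3\rho^3V_0(K)$, $\rho\ge0$, where $B^3$ is the Euclidean unit ball. *)

theory Defs
  imports "HOL-Probability.Probability"
begin

definition convex_body :: "'a::euclidean_space set \<Rightarrow> bool" where
  "convex_body K \<longleftrightarrow> compact K \<and> convex K \<and> interior K \<noteq> {}"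

definition centrally_symmetric :: "'a::real_vector set \<Rightarrow> bool" where
  "centrally_symmetric K \<longleftrightarrow> (\<exists>c. (\<lambda>x. 2 *\<^sub>R c - x) ` K = K)"

definition support_function :: "(real^2) set \<Rightarrow> real \<Rightarrow> real" where
  "support_function P \<theta> = (SUP x\<in>P. x \<bullet> vector [cos \<theta>, sin \<theta>])"

definition prism :: "(real^2) set \<Rightarrow> real \<Rightarrow> (real^3) set" where
  "prism P H = {x. vector [x $ 1, x $ 2] \<in> P \<and> x $ 3 \<in> {- H / 2 .. H / 2}}"

definition width :: "(real^3) set \<Rightarrow> real^3 \<Rightarrow> real" where
  "width K u = (SUP x\<in>K. u \<bullet> x) - (INF x\<in>K. u \<bullet> x)"

text \<open>The area of a subset \<open>S\<close> of the plane orthogonal to \<open>u\<close> is the Lebesgue measure of its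
  preimage under a linear isometry from the coordinate plane onto that plane. The value does not
  depend on the isometry.\<close>

definition plane_area :: "real^3 \<Rightarrow> (real^3) set \<Rightarrow> real" where
  "plane_area u S = (THE a. \<exists>T :: real^2 \<Rightarrow> real^3. linear T \<and> (\<forall>y. norm (T y) = norm y) \<and>
     range T = {x. u \<bullet> x = 0} \<and> a = measure lebesgue (T -` S))"

text \<open>The formula for the orthogonal projection presupposes that \<open>u\<close> is a unit vector.\<close>

definition brightness :: "(real^3) set \<Rightarrow> real^3 \<Rightarrow> real" where
  "brightness K u = plane_area u ((\<lambda>x. x - (u \<bullet> x) *\<^sub>R u) ` K)"

definition steiner_formula :: "(real^3) set \<Rightarrow> (nat \<Rightarrow> real) \<Rightarrow> bool" where
  "steiner_formula K V \<longleftrightarrow> V 0 = 1 \<and>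
     (\<forall>\<rho>\<ge>0. measure lebesgue {x + y |x y. x \<in> K \<and> y \<in> cball 0 \<rho>} =
        V 3 + 2 * \<rho> * V 2 + pi * \<rho>\<^sup>2 * V 1 + 4 * pi / 3 * \<rho> ^ 3 * V 0)"

text \<open>Meaningful for \<open>j \<le> 3\<close> only, where the polynomial in the Steiner formula determines the
  coefficient.\<close>

definition intrinsic_volume :: "nat \<Rightarrow> (real^3) set \<Rightarrow> real" where
  "intrinsic_volume j K = (THE a. \<exists>V. steiner_formula K V \<and> a = V j)"

text \<open>The uniform distribution on the unit sphere, as the radial projection of the uniform
  distribution on the ball: a Borel set \<open>A\<close> of directions gets the share of the ball taken by
  the cone over \<open>A\<close>, which is its normalized surface area. The restriction makes the sphere
  itself the sample space, so that functions on it need only be measurable there; the centre of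
  the ball, sent to 0 by \<open>sgn\<close>, is a null set.\<close>

definition uniform_sphere :: "(real^3) measure" where
  "uniform_sphere = restrict_space (distr (uniform_measure lborel (cball 0 1)) borel sgn) (sphere 0 1)"

definition width_law :: "(real^3) set \<Rightarrow> real measure" where
  "width_law K = distr uniform_sphere borel (width K)"

definition brightness_law :: "(real^3) set \<Rightarrow> real measure" where
  "brightness_law K = distr uniform_sphere borel (brightness K)"

end

theory Submission imports Defs begin

text \<open>A plane body whose support function \<open>h\<close> satisfies \<open>h + h'' > 0\<close> is swept out by the
  segments from the origin to the point \<open>p(\<theta>)\<close> of contact with the supporting line of normal angle
  \<open>\<theta>\<close>. This gives its area as half the integral of \<open>h (h + h'')\<close>. Since the parallel body at
  distance \<open>r\<close> has support function \<open>h + r\<close>, slicing the parallel bodies of the prism horizontally yields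
  the Steiner polynomial. The coefficients depend on \<open>h = 1 + a cos (n \<theta>)\<close> only through
  \<open>(n\<^sup>2 - 1) a\<^sup>2\<close>, which is \<open>3 t\<^sup>2\<close> for both bodies.

  For a unit direction with horizontal part of length \<open>\<rho>\<close> and angle \<open>\<theta>\<close> and vertical part \<open>z\<close>, the width of
  the prism is \<open>H |z| + 2 \<rho> h(\<theta>)\<close>. Its shadow, sliced parallel to the vertical plane through the
  direction, has area \<open>A |z| + 2 H \<rho> h(\<theta> + \<pi>/2)\<close>. The second moments need only the
  orthogonal invariance of the uniform distribution: a rotation about the vertical axis by \<open>\<pi>/n\<close>
  negates \<open>cos (n \<theta>)\<close> and kills the terms linear in \<open>a\<close>, and a rotation by \<open>\<pi>/(2 n)\<close> exchanges
  \<open>cos\<^sup>2 (n \<theta>)\<close> and \<open>sin\<^sup>2 (n \<theta>)\<close>, so the second moments see \<open>a\<^sup>2\<close> itself, which is \<open>t\<^sup>2\<close> for one body and \<open>t\<^sup>2/5\<close> for the other.\<close>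

section \<open>Coordinates in the plane and in space\<close>

definition dir :: "real \<Rightarrow> real^2" where
  "dir \<theta> = vector [cos \<theta>, sin \<theta>]"

lemma inner_real2: "(x::real^2) \<bullet> y = x $ 1 * y $ 1 + x $ 2 * y $ 2"
  by (simp add: inner_vec_def sum_2)

lemma norm_real2: "norm (x::real^2) = sqrt ((x $ 1)\<^sup>2 + (x $ 2)\<^sup>2)"
  by (simp add: norm_eq_sqrt_inner inner_real2 power2_eq_square)

lemma vec2_eq_iff: "(x::real^2) = y \<longleftrightarrow> x $ 1 = y $ 1 \<and> x $ 2 = y $ 2"
  by (simp add: vec_eq_iff forall_2)

lemma vector_2_nth [simp]: "(vector [x $ 1, x $ 2] :: real^2) = x"
  by (simp add: vec2_eq_iff)

lemma dir_nth [simp]: "dir \<theta> $ 1 = cos \<theta>" "dir \<theta> $ 2 = sin \<theta>"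
  by (simp_all add: dir_def)

lemma norm_dir [simp]: "norm (dir \<theta>) = 1"
  by (simp add: norm_real2)

lemma dir_2pi_int [simp]: "dir (\<theta> + of_int k * (2 * pi)) = dir \<theta>"
  using sin_int_2pin[of k] cos_int_2pin[of k] by (simp add: vec2_eq_iff sin_add cos_add ac_simps)

lemma real2_polar:
  fixes x :: "real^2"
  obtains \<theta> where "x = norm x *\<^sub>R dir \<theta>"
proof (cases "x = 0")
  case False
  define y where "y = x /\<^sub>R norm x"
  have "norm y = 1" using False by (simp add: y_def)
  then have "(y $ 1)\<^sup>2 + (y $ 2)\<^sup>2 = 1" by (simp add: norm_real2)
  then obtain \<theta> where "y $ 1 = cos \<theta>" "y $ 2 = sin \<theta>"
    by (metis sincos_total_2pi)
  then have "y = dir \<theta>" by (simp add: vec2_eq_iff)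
  moreover have "x = norm x *\<^sub>R y" using False by (simp add: y_def)
  ultimately show ?thesis using that by metis
qed (use that in auto)

text \<open>The Wulff shape of \<open>h\<close>, an intersection of half-planes. A convex body is
  the Wulff shape of its support function; that conversely \<open>h\<close> is the support function
  of its Wulff shape needs a condition on \<open>h\<close>, here \<open>h + h'' > 0\<close>.\<close>

definition support_body :: "(real \<Rightarrow> real) \<Rightarrow> (real^2) set" where
  "support_body h = {x. \<forall>\<theta>. x \<bullet> dir \<theta> \<le> h \<theta>}"

lemma support_function_dir: "support_function P \<theta> = (SUP x\<in>P. x \<bullet> dir \<theta>)"
  by (simp add: support_function_def dir_def)

lemma bdd_above_inner_image: "compact P \<Longrightarrow> bdd_above ((\<lambda>x. x \<bullet> (u::'a::euclidean_space)) ` P)"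
  by (intro compact_imp_bounded bounded_imp_bdd_above compact_continuous_image continuous_intros)

text \<open>A point outside \<open>P\<close> is cut off by a line, and the direction normal to that
  line is one in which the point violates the support inequality. This makes a plane body unique
  once its support function is given.\<close>

lemma convex_body_eq_support_body:
  assumes "convex_body P"
  shows "P = support_body (support_function P)"
proof
  have P: "compact P" "convex P" "P \<noteq> {}"
    using assms by (auto simp: convex_body_def)
  show "P \<subseteq> support_body (support_function P)"
    by (auto simp: support_body_def support_function_dir intro!: cSUP_upper bdd_above_inner_image P)
  show "support_body (support_function P) \<subseteq> P"
  proof (rule ccontr)
    assume "\<not> ?thesis"
    then obtain z where z: "z \<in> support_body (support_function P)" "z \<notin> P" by blast
    obtain a b where ab: "a \<bullet> z < b" "\<And>x. x \<in> P \<Longrightarrow> b < a \<bullet> x"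
      using separating_hyperplane_closed_point[OF P(2) compact_imp_closed[OF P(1)] z(2)] by auto
    \<comment> \<open>The separation puts \<open>P\<close> on the side
      \<open>b < a \<bullet> x\<close>, so the outer normal is \<open>- a\<close>.\<close>
    obtain \<theta> where \<theta>: "- a = norm (- a) *\<^sub>R dir \<theta>" by (rule real2_polar)
    have "a \<noteq> 0" using ab P(3) by force
    have "x \<bullet> dir \<theta> \<le> - b / norm a" if "x \<in> P" for x
    proof -
      have "x \<bullet> (- a) = norm a * (x \<bullet> dir \<theta>)" using \<theta> by (metis inner_scaleR_right norm_minus_cancel)
      then show ?thesis using ab(2)[OF that] \<open>a \<noteq> 0\<close> by (simp add: field_simps inner_commute)
    qed
    then have "support_function P \<theta> \<le> - b / norm a"
      unfolding support_function_dir by (intro cSUP_least P)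
    moreover have "z \<bullet> dir \<theta> \<le> support_function P \<theta>" using z(1) by (simp add: support_body_def)
    moreover have "z \<bullet> (- a) = norm a * (z \<bullet> dir \<theta>)" using \<theta> by (metis inner_scaleR_right norm_minus_cancel)
    ultimately have "z \<bullet> (- a) \<le> - b"
      using mult_left_mono[of "z \<bullet> dir \<theta>" "- b / norm a" "norm a"] \<open>a \<noteq> 0\<close> by simp
    then show False using ab(1) by (simp add: inner_commute)
  qed
qed

section \<open>Lebesgue measure of plane and space sets by slices\<close>

lemma prod_Basis_cart: "(\<Prod>b\<in>Basis. (x :: real^'n) \<bullet> b) = (\<Prod>i\<in>UNIV. x $ i)"
proof -
  have B: "Basis = range (\<lambda>i. axis i (1::real) :: real^'n)" by (auto simp: Basis_vec_def)
  have "inj (\<lambda>i. axis i (1::real) :: real^'n)" by (auto simp: inj_on_def axis_eq_axis)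
  then show ?thesis unfolding B by (simp add: prod.reindex cart_eq_inner_axis)
qed

lemma vector2_eq_sum: "vector [x, y] = (x *\<^sub>R axis 1 1 + y *\<^sub>R axis 2 1 :: real^2)"
  by (simp add: vec2_eq_iff axis_def)

lemma continuous_on_vector2 [continuous_intros]:
  assumes "continuous_on S f" "continuous_on S g"
  shows "continuous_on S (\<lambda>x. vector [f x, g x] :: real^2)"
  unfolding vector2_eq_sum by (intro continuous_intros assms)

lemma continuous_on_dir [continuous_intros]:
  "continuous_on S f \<Longrightarrow> continuous_on S (\<lambda>x. dir (f x))" for f :: "'a::t2_space \<Rightarrow> real"
  unfolding dir_def by (intro continuous_on_vector2 continuous_on_cos continuous_on_sin)

lemma measurable_vector2 [measurable (raw)]:
  assumes "f \<in> borel_measurable M" "g \<in> borel_measurable M"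
  shows "(\<lambda>x. vector [f x, g x] :: real^2) \<in> borel_measurable M"
  unfolding vector2_eq_sum using assms by measurable

lemma measurable_vec_nth [measurable (raw)]:
  "f \<in> borel_measurable M \<Longrightarrow> (\<lambda>x. f x $ i) \<in> borel_measurable M" for f :: "'a \<Rightarrow> real^'n"
  by (rule borel_measurable_continuous_on) (auto intro!: continuous_intros)

lemma measurable_real2_pair [measurable]:
  "(\<lambda>q. vector [fst q, snd q] :: real^2) \<in> borel_measurable borel"
  by (intro borel_measurable_continuous_onI continuous_intros)

text \<open>Lebesgue measure is determined by its values on boxes, and a box of the plane pulls back
  to a product of intervals. Tonelli for product measures thereby becomes available in
  \<open>real^2\<close>.\<close>

lemma lborel_real2: "distr lborel borel (\<lambda>q. vector [fst q, snd q]) = (lborel :: (real^2) measure)"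
proof (rule lborel_eqI[symmetric])
  fix l u :: "real^2"
  assume "\<And>b. b \<in> Basis \<Longrightarrow> l \<bullet> b \<le> u \<bullet> b"
  then have lu: "l $ 1 \<le> u $ 1" "l $ 2 \<le> u $ 2"
    by (simp_all add: cart_eq_inner_axis)
  have "emeasure (distr lborel borel (\<lambda>q. vector [fst q, snd q] :: real^2)) (box l u) =
    emeasure lborel ({l $ 1 <..< u $ 1} \<times> {l $ 2 <..< u $ 2})"
    by (subst emeasure_distr) (auto intro!: arg_cong[where f = "emeasure lborel"] simp: mem_box_cart forall_2)
  also have "\<dots> = ennreal ((u $ 1 - l $ 1) * (u $ 2 - l $ 2))"
    using lu by (simp add: lborel_prod[symmetric] lborel.emeasure_pair_measure_Times ennreal_mult)
  also have "(u $ 1 - l $ 1) * (u $ 2 - l $ 2) = (\<Prod>b\<in>Basis. (u - l) \<bullet> b)"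
    by (simp only: prod_Basis_cart) (simp add: UNIV_2)
  finally show "emeasure (distr lborel borel (\<lambda>q. vector [fst q, snd q] :: real^2)) (box l u) =
    (\<Prod>b\<in>Basis. (u - l) \<bullet> b)" .
qed simp

lemma nn_integral_real2:
  assumes [measurable]: "f \<in> borel_measurable borel"
  shows "(\<integral>\<^sup>+v. f v \<partial>lborel) = (\<integral>\<^sup>+x. \<integral>\<^sup>+y. f (vector [x, y] :: real^2) \<partial>lborel \<partial>lborel)"
proof -
  have "(\<integral>\<^sup>+v. f v \<partial>lborel) = (\<integral>\<^sup>+q. f (vector [fst q, snd q]) \<partial>lborel)"
    by (subst lborel_real2[symmetric], subst nn_integral_distr) auto
  then show ?thesis
    by (simp add: lborel_prod[symmetric] lborel.nn_integral_fst[symmetric])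
qed

lemma measurable_emeasure_real2_slice:
  fixes S :: "(real^2) set"
  assumes [measurable]: "S \<in> sets borel"
  shows "(\<lambda>x. emeasure lborel {y. vector [x, y] \<in> S}) \<in> borel_measurable borel"
proof -
  have "(\<lambda>q :: real \<times> real. vector [fst q, snd q] :: real^2) -` S \<in> sets (lborel \<Otimes>\<^sub>M lborel)"
    unfolding lborel_prod using measurable_sets_borel[OF measurable_real2_pair assms] by simp
  from lborel.measurable_emeasure_Pair[OF this] show ?thesis
    by (simp add: vimage_def)
qed

lemma emeasure_real2_slices:
  fixes S :: "(real^2) set"
  assumes [measurable]: "S \<in> sets borel"
  shows "emeasure lborel S = (\<integral>\<^sup>+x. emeasure lborel {y. vector [x, y] \<in> S} \<partial>lborel)"
proof -
  have slice: "(\<integral>\<^sup>+y. indicator S (vector [x, y] :: real^2) \<partial>lborel) = emeasure lborel {y. vector [x, y] \<in> S}" for x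
  proof -
    have "{y. vector [x, y] \<in> S} \<in> sets lborel"
      by measurable
    then have "emeasure lborel {y. vector [x, y] \<in> S} = (\<integral>\<^sup>+y. indicator {y. vector [x, y] \<in> S} y \<partial>lborel)"
      by simp
    then show ?thesis by (simp only: indicator_def mem_Collect_eq)
  qed
  have "emeasure lborel S = (\<integral>\<^sup>+v. indicator S v \<partial>lborel)" by simp
  also have "\<dots> = (\<integral>\<^sup>+x. \<integral>\<^sup>+y. indicator S (vector [x, y] :: real^2) \<partial>lborel \<partial>lborel)"
    by (rule nn_integral_real2) measurable
  finally show ?thesis by (simp only: slice)
qed

lemma vector_3_eq_sum: "vector [x, y, z] = (x *\<^sub>R axis 1 1 + y *\<^sub>R axis 2 1 + z *\<^sub>R axis 3 1 :: real^3)"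
  by (simp add: vec_eq_iff forall_3 axis_def)

lemma inner_real3: "(x::real^3) \<bullet> y = x $ 1 * y $ 1 + x $ 2 * y $ 2 + x $ 3 * y $ 3"
  by (simp add: inner_vec_def sum_3)

lemma norm_real3: "norm (x::real^3) = sqrt ((x $ 1)\<^sup>2 + (x $ 2)\<^sup>2 + (x $ 3)\<^sup>2)"
  by (simp add: norm_eq_sqrt_inner inner_real3 power2_eq_square)

lemma vec3_eq_iff: "(x::real^3) = y \<longleftrightarrow> x $ 1 = y $ 1 \<and> x $ 2 = y $ 2 \<and> x $ 3 = y $ 3"
  by (simp add: vec_eq_iff forall_3)

lemma continuous_on_vector3 [continuous_intros]:
  assumes "continuous_on S f" "continuous_on S g" "continuous_on S k"
  shows "continuous_on S (\<lambda>x. vector [f x, g x, k x] :: real^3)"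
  unfolding vector_3_eq_sum by (intro continuous_intros assms)

lemma measurable_vector3 [measurable (raw)]:
  assumes "f \<in> borel_measurable M" "g \<in> borel_measurable M" "k \<in> borel_measurable M"
  shows "(\<lambda>x. vector [f x, g x, k x] :: real^3) \<in> borel_measurable M"
  unfolding vector_3_eq_sum using assms by measurable

lemma measurable_real3_pair [measurable]:
  "(\<lambda>q :: real \<times> (real^2). vector [snd q $ 1, snd q $ 2, fst q] :: real^3) \<in> borel_measurable borel"
  by (intro borel_measurable_continuous_onI continuous_intros)

text \<open>As in the plane, boxes decide. The height is the first factor of the pair, so that the
  inner integral of Tonelli runs over a horizontal slice.\<close>

lemma lborel_real3: "distr lborel borel (\<lambda>q :: real \<times> (real^2). vector [snd q $ 1, snd q $ 2, fst q]) = (lborel :: (real^3) measure)"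
proof (rule lborel_eqI[symmetric])
  fix l u :: "real^3"
  assume "\<And>b. b \<in> Basis \<Longrightarrow> l \<bullet> b \<le> u \<bullet> b"
  then have lu: "l $ 1 \<le> u $ 1" "l $ 2 \<le> u $ 2" "l $ 3 \<le> u $ 3"
    by (simp_all add: cart_eq_inner_axis)
  have "emeasure (distr lborel borel (\<lambda>q :: real \<times> (real^2). vector [snd q $ 1, snd q $ 2, fst q] :: real^3)) (box l u) =
    emeasure lborel ({l $ 3 <..< u $ 3} \<times> box (vector [l $ 1, l $ 2]) (vector [u $ 1, u $ 2] :: real^2))"
    by (subst emeasure_distr)
       (auto intro!: arg_cong[where f = "emeasure lborel"] simp: mem_box_cart forall_2 forall_3)
  also have "\<dots> = ennreal (u $ 3 - l $ 3) * emeasure lborel (box (vector [l $ 1, l $ 2]) (vector [u $ 1, u $ 2] :: real^2))"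
    using lu by (simp add: lborel_prod[symmetric] lborel.emeasure_pair_measure_Times)
  also have "emeasure lborel (box (vector [l $ 1, l $ 2]) (vector [u $ 1, u $ 2] :: real^2)) =
      ennreal ((u $ 1 - l $ 1) * (u $ 2 - l $ 2))"
  proof -
    have "\<forall>i. (vector [l $ 1, l $ 2] :: real^2) $ i \<le> (vector [u $ 1, u $ 2] :: real^2) $ i"
      using lu by (simp add: forall_2)
    then have "vector [l $ 1, l $ 2] \<bullet> b \<le> (vector [u $ 1, u $ 2] :: real^2) \<bullet> b" if "b \<in> Basis" for b
      using that by (auto simp: Basis_vec_def inner_axis)
    then show ?thesis
      by (simp only: emeasure_lborel_box prod_Basis_cart) (simp add: UNIV_2)
  qed
  also have "ennreal (u $ 3 - l $ 3) * ennreal ((u $ 1 - l $ 1) * (u $ 2 - l $ 2)) =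
      ennreal ((u $ 1 - l $ 1) * (u $ 2 - l $ 2) * (u $ 3 - l $ 3))"
    using lu by (subst ennreal_mult'[symmetric]) (auto simp: mult.commute)
  also have "(u $ 1 - l $ 1) * (u $ 2 - l $ 2) * (u $ 3 - l $ 3) = (\<Prod>b\<in>Basis. (u - l) \<bullet> b)"
    unfolding prod_Basis_cart UNIV_3 by (simp add: mult.assoc)
  finally show "emeasure (distr lborel borel (\<lambda>q :: real \<times> (real^2). vector [snd q $ 1, snd q $ 2, fst q] :: real^3)) (box l u) =
    (\<Prod>b\<in>Basis. (u - l) \<bullet> b)" .
qed simp

lemma emeasure_real3_slices:
  fixes S :: "(real^3) set"
  assumes [measurable]: "S \<in> sets borel"
  shows "emeasure lborel S = (\<integral>\<^sup>+z. emeasure lborel {p :: real^2. vector [p $ 1, p $ 2, z] \<in> S} \<partial>lborel)"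
proof -
  have slice: "(\<integral>\<^sup>+p. indicator S (vector [(p :: real^2) $ 1, p $ 2, z] :: real^3) \<partial>lborel) =
      emeasure lborel {p :: real^2. vector [p $ 1, p $ 2, z] \<in> S}" for z
  proof -
    have "{p::real^2. vector [p $ 1, p $ 2, z] \<in> S} \<in> sets lborel"
      by measurable
    then have "emeasure lborel {p::real^2. vector [p $ 1, p $ 2, z] \<in> S} =
        (\<integral>\<^sup>+p. indicator {p :: real^2. vector [p $ 1, p $ 2, z] \<in> S} p \<partial>lborel)"
      by simp
    then show ?thesis by (simp only: indicator_def mem_Collect_eq)
  qed
  have "emeasure lborel S = (\<integral>\<^sup>+v. indicator S v \<partial>lborel)" by simp
  also have "\<dots> = (\<integral>\<^sup>+q. indicator S (vector [snd q $ 1, snd q $ 2, fst q] :: real^3) \<partial>(lborel :: (real \<times> (real^2)) measure))"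
    by (subst lborel_real3[symmetric], subst nn_integral_distr) auto
  also have "\<dots> = (\<integral>\<^sup>+z. \<integral>\<^sup>+p. indicator S (vector [(p :: real^2) $ 1, p $ 2, z] :: real^3) \<partial>lborel \<partial>lborel)"
    by (simp add: lborel_prod[symmetric] lborel.nn_integral_fst[symmetric])
  finally show ?thesis by (simp only: slice)
qed

section \<open>Plane bodies with smooth support function\<close>

text \<open>Periodicity makes \<open>h\<close> a function of the direction, \<open>h + h''\<close>
  is the radius of curvature of the boundary at the point with normal angle \<theta>, and
  \<open>0 < h\<close> puts the origin in the interior.\<close>

locale plane_support =
  fixes h h' h'' :: "real \<Rightarrow> real"
  assumes deriv: "(h has_real_derivative h' \<theta>) (at \<theta>)"
    and deriv': "(h' has_real_derivative h'' \<theta>) (at \<theta>)"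
    and continuous'': "continuous_on UNIV h''"
    and periodic: "h (\<theta> + 2 * pi) = h \<theta>"
    and curvature_pos: "0 < h \<theta> + h'' \<theta>"
    and pos: "0 < h \<theta>"
begin

text \<open>The envelope of the supporting lines: the point with coordinates \<open>h\<close> and
  \<open>h'\<close> in the orthonormal frame formed by the normal \<open>dir \<theta>\<close> and
  the tangent \<open>dir (\<theta> + pi / 2)\<close>.\<close>

definition touch :: "real \<Rightarrow> real^2" where
  "touch \<theta> = vector [h \<theta> * cos \<theta> - h' \<theta> * sin \<theta>, h \<theta> * sin \<theta> + h' \<theta> * cos \<theta>]"

lemma touch_nth [simp]:
  "touch \<theta> $ 1 = h \<theta> * cos \<theta> - h' \<theta> * sin \<theta>" "touch \<theta> $ 2 = h \<theta> * sin \<theta> + h' \<theta> * cos \<theta>"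
  by (simp_all add: touch_def)

lemma periodic_int: "h (\<theta> + of_int k * (2 * pi)) = h \<theta>"
proof -
  interpret periodic_fun_simple h "2 * pi" by standard (rule periodic)
  show ?thesis by (rule plus_of_int)
qed

lemma continuous: "continuous_on S h"
  by (rule DERIV_continuous_on) (rule has_field_derivative_at_within, rule deriv)

lemma touch_inner_dir: "touch \<theta> \<bullet> dir \<phi> = h \<theta> * cos (\<phi> - \<theta>) + h' \<theta> * sin (\<phi> - \<theta>)"
  by (simp add: inner_real2 cos_diff sin_diff algebra_simps)

lemma touch_inner_dir_self: "touch \<theta> \<bullet> dir \<theta> = h \<theta>"
  by (simp add: touch_inner_dir)

text \<open>For fixed \<phi> the function \<open>touch s \<bullet> dir \<phi>\<close> of
  \<open>s\<close> has derivative \<open>(h s + h'' s) * sin (\<phi> - s)\<close>. Within half a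
  turn the sine keeps its sign, so the function strictly increases as \<open>s\<close> moves from
  \<theta> to \<phi>, where its value is \<open>h \<phi>\<close>.\<close>

lemma touch_inner_dir_less_near:
  assumes "\<phi> \<noteq> \<theta>" "\<bar>\<phi> - \<theta>\<bar> \<le> pi"
  shows "touch \<theta> \<bullet> dir \<phi> < h \<phi>"
proof -
  define F where "F s = h s * cos (\<phi> - s) + h' s * sin (\<phi> - s)" for s
  have F: "(F has_real_derivative (h s + h'' s) * sin (\<phi> - s)) (at s)" for s
    unfolding F_def
    by (rule derivative_eq_intros deriv deriv' refl)+ (simp add: algebra_simps)
  have cont: "continuous_on S F" for S
    by (rule DERIV_continuous_on) (rule has_field_derivative_at_within, rule F)
  have "F \<theta> < F \<phi>"
  proof (cases "\<theta> < \<phi>")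
    case True
    then show ?thesis
    \<comment> \<open>Only the open interval is available: the sine vanishes at
      \<open>s = \<phi>\<close>, and also at \<theta> when the two angles are half a turn
      apart.\<close>
    proof (rule DERIV_pos_imp_increasing_open)
      fix s assume "\<theta> < s" "s < \<phi>"
      then have "0 < sin (\<phi> - s)" using assms True by (intro sin_gt_zero) auto
      then show "\<exists>y. (F has_real_derivative y) (at s) \<and> 0 < y"
        using F curvature_pos by (meson mult_pos_pos)
    qed (rule cont)
  next
    case False
    then have "\<phi> < \<theta>" using assms by simp
    then show ?thesis
    proof (rule DERIV_neg_imp_decreasing_open)
      fix s assume s: "\<phi> < s" "s < \<theta>"
      then have "0 < sin (s - \<phi>)" using assms False by (intro sin_gt_zero) auto
      then have "sin (\<phi> - s) < 0" using sin_minus[of "s - \<phi>"] by simp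
      then show "\<exists>y. (F has_real_derivative y) (at s) \<and> y < 0"
        using F curvature_pos by (meson mult_pos_neg)
    qed (rule cont)
  qed
  then show ?thesis by (simp add: F_def touch_inner_dir)
qed

lemma angle_reduce:
  obtains k :: int where "\<bar>\<phi> + of_int k * (2 * pi) - \<theta>\<bar> \<le> pi"
proof -
  define k where "k = round ((\<theta> - \<phi>) / (2 * pi))"
  have "\<bar>of_int k - (\<theta> - \<phi>) / (2 * pi)\<bar> \<le> 1 / 2"
    unfolding k_def by (rule of_int_round_abs_le)
  then have "\<bar>of_int k - (\<theta> - \<phi>) / (2 * pi)\<bar> * (2 * pi) \<le> pi"
    by (simp add: field_simps)
  also have "\<bar>of_int k - (\<theta> - \<phi>) / (2 * pi)\<bar> * (2 * pi) =
      \<bar>(of_int k - (\<theta> - \<phi>) / (2 * pi)) * (2 * pi)\<bar>"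
    by (simp add: abs_mult)
  also have "(of_int k - (\<theta> - \<phi>) / (2 * pi)) * (2 * pi) = \<phi> + of_int k * (2 * pi) - \<theta>"
    by (simp add: field_simps)
  finally show ?thesis by (rule that)
qed

text \<open>Shifting \<phi> by full turns reduces to the previous case. Strictness is what later
  recovers the angle from the point of contact.\<close>

lemma touch_inner_dir_less:
  assumes "\<And>k::int. \<theta> \<noteq> \<phi> + of_int k * (2 * pi)"
  shows "touch \<theta> \<bullet> dir \<phi> < h \<phi>"
proof -
  obtain k :: int where "\<bar>\<phi> + of_int k * (2 * pi) - \<theta>\<bar> \<le> pi" by (rule angle_reduce)
  then have "touch \<theta> \<bullet> dir (\<phi> + of_int k * (2 * pi)) < h (\<phi> + of_int k * (2 * pi))"
    using assms[of k] by (intro touch_inner_dir_less_near) auto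
  then show ?thesis by (simp add: periodic_int)
qed

lemma touch_inner_dir_le: "touch \<theta> \<bullet> dir \<phi> \<le> h \<phi>"
proof (cases "\<exists>k::int. \<theta> = \<phi> + of_int k * (2 * pi)")
  case True
  then show ?thesis
    by (metis touch_inner_dir_self dir_2pi_int periodic_int order.refl)
qed (use touch_inner_dir_less less_imp_le in blast)

lemma touch_in_body: "touch \<theta> \<in> support_body h"
  by (simp add: support_body_def touch_inner_dir_le)

lemma closed_body: "closed (support_body h)"
  unfolding support_body_def by (intro closed_Collect_all closed_Collect_le continuous_intros)

lemma convex_support_body: "convex (support_body h)"
proof -
  have "support_body h = (\<Inter>\<theta>. {x. dir \<theta> \<bullet> x \<le> h \<theta>})"
    by (auto simp: support_body_def inner_commute)
  then show ?thesis by (auto intro!: convex_INT convex_halfspace_le)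
qed

lemma bounded_body: "bounded (support_body h)"
proof (rule bounded_subset[OF bounded_cbox])
  show "support_body h \<subseteq> cbox (vector [- h pi, - h (- (pi / 2))]) (vector [h 0, h (pi / 2)])"
  proof
    fix x assume "x \<in> support_body h"
    then have "x \<bullet> dir 0 \<le> h 0" "x \<bullet> dir pi \<le> h pi" "x \<bullet> dir (pi / 2) \<le> h (pi / 2)"
      "x \<bullet> dir (- (pi / 2)) \<le> h (- (pi / 2))"
      unfolding support_body_def by blast+
    then show "x \<in> cbox (vector [- h pi, - h (- (pi / 2))]) (vector [h 0, h (pi / 2)])"
      by (simp add: mem_box_cart forall_2 inner_real2)
  qed
qed

lemma compact_body: "compact (support_body h)"
  using bounded_body closed_body compact_eq_bounded_closed by blast

text \<open>The minimum of \<open>h\<close> over one period is attained, hence positive, and serves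
  as radius.\<close>

lemma ball_subset_body:
  obtains r where "0 < r" "ball 0 r \<subseteq> support_body h"
proof -
  obtain \<theta>0 where \<theta>0: "\<And>\<theta>. \<theta> \<in> {- pi..pi} \<Longrightarrow> h \<theta>0 \<le> h \<theta>"
    using continuous_attains_inf[of "{- pi..pi}" h] continuous by force
  have "x \<bullet> dir \<phi> \<le> h \<phi>" if "x \<in> ball 0 (h \<theta>0)" for x \<phi>
  proof -
    obtain k :: int where "\<bar>\<phi> + of_int k * (2 * pi) - 0\<bar> \<le> pi" by (rule angle_reduce)
    then have "h \<theta>0 \<le> h (\<phi> + of_int k * (2 * pi))" by (intro \<theta>0) auto
    then have "h \<theta>0 \<le> h \<phi>" by (simp add: periodic_int)
    moreover have "x \<bullet> dir \<phi> \<le> norm x"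
      using norm_cauchy_schwarz[of x "dir \<phi>"] by simp
    ultimately show ?thesis using that by simp
  qed
  then have "ball 0 (h \<theta>0) \<subseteq> support_body h" by (auto simp: support_body_def)
  with pos show ?thesis by (rule that)
qed

lemma convex_body_support_body: "convex_body (support_body h)"
proof -
  obtain r where "0 < r" "ball 0 r \<subseteq> support_body h" by (rule ball_subset_body)
  then have "0 \<in> interior (support_body h)"
    using interior_maximal[of "ball 0 r" "support_body h"] by auto
  then show ?thesis
    using compact_body convex_support_body by (auto simp: convex_body_def)
qed

text \<open>The supremum is attained at \<open>touch \<theta>\<close>, which lies in the body
  because \<open>h + h''\<close> is positive.\<close>

lemma support_function_body: "support_function (support_body h) = h"
proof
  fix \<theta>
  show "support_function (support_body h) \<theta> = h \<theta>"
    unfolding support_function_dir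
  proof (rule cSup_eq_maximum)
    show "h \<theta> \<in> (\<lambda>x. x \<bullet> dir \<theta>) ` support_body h"
      using touch_in_body touch_inner_dir_self by (metis imageI)
  qed (auto simp: support_body_def)
qed

text \<open>The scale \<open>s\<close> is the gauge of \<open>x\<close>, the maximum over \<theta>
  of \<open>(x \<bullet> dir \<theta>) / h \<theta>\<close>. At a maximizing angle
  \<open>s * h \<theta> - x \<bullet> dir \<theta>\<close> has minimum 0, so this difference and its
  derivative vanish there. These two equations give the normal and the tangential component of
  \<open>x\<close>, namely \<open>s * h\<close> and \<open>s * h'\<close>.\<close>

lemma body_polar:
  assumes "x \<in> support_body h" "x \<noteq> 0"
  obtains s \<theta> where "0 < s" "s \<le> 1" "- pi \<le> \<theta>" "\<theta> < pi" "x = s *\<^sub>R touch \<theta>"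
proof -
  define f where "f \<theta> = (x \<bullet> dir \<theta>) / h \<theta>" for \<theta>
  have per: "f (\<theta> + of_int k * (2 * pi)) = f \<theta>" for \<theta> k
    by (simp add: f_def periodic_int)
  have "continuous_on {- pi..pi} f"
    unfolding f_def using pos continuous
    by (intro continuous_intros) (auto simp: less_imp_neq[THEN not_sym])
  then obtain \<theta>1 where \<theta>1: "\<theta>1 \<in> {- pi..pi}" "\<And>\<theta>. \<theta> \<in> {- pi..pi} \<Longrightarrow> f \<theta> \<le> f \<theta>1"
    using continuous_attains_sup[of "{- pi..pi}" f] by force
  \<comment> \<open>A maximizer at the right end of the period is moved to the left end, since the
    angle has to lie in a half-open interval to be unique.\<close>
  define \<theta>0 where "\<theta>0 = (if \<theta>1 = pi then - pi else \<theta>1)"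
  have \<theta>0: "- pi \<le> \<theta>0" "\<theta>0 < pi" using \<theta>1 by (auto simp: \<theta>0_def)
  have f01: "f \<theta>0 = f \<theta>1" using per[of "- pi" 1] by (simp add: \<theta>0_def)
  have le: "f \<theta> \<le> f \<theta>0" for \<theta>
  proof -
    obtain k :: int where "\<bar>\<theta> + of_int k * (2 * pi) - 0\<bar> \<le> pi" by (rule angle_reduce)
    then have "f (\<theta> + of_int k * (2 * pi)) \<le> f \<theta>1" by (intro \<theta>1) auto
    then show ?thesis by (simp add: per f01)
  qed
  define s where "s = f \<theta>0"
  have "s \<le> 1"
    using assms(1) pos[of \<theta>0] by (simp add: s_def f_def support_body_def)
  \<comment> \<open>The direction of \<open>x\<close> itself gives a positive quotient, so the
    maximum is positive.\<close>
  obtain \<theta>x where "x = norm x *\<^sub>R dir \<theta>x" by (rule real2_polar)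
  then have "x \<bullet> dir \<theta>x = norm x" 
    by (metis inner_scaleR_left mult.right_neutral norm_dir norm_eq_1)
  then have "0 < f \<theta>x" using assms(2) pos by (simp add: f_def)
  then have "0 < s" using le[of \<theta>x] by (simp add: s_def)
  \<comment> \<open>\<open>k\<close> is nonnegative everywhere and zero at \<open>\<theta>0\<close>,
    so its derivative vanishes there.\<close>
  define k where "k \<theta> = s * h \<theta> - x \<bullet> dir \<theta>" for \<theta>
  have k: "(k has_real_derivative s * h' \<theta> - (- x $ 1 * sin \<theta> + x $ 2 * cos \<theta>)) (at \<theta>)" for \<theta>
    unfolding k_def inner_real2 dir_nth
    by (rule derivative_eq_intros deriv refl)+ simp
  have k0: "k \<theta>0 = 0" using pos[of \<theta>0] by (simp add: k_def s_def f_def)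
  have "0 \<le> k \<theta>" for \<theta>
    using le[of \<theta>] pos[of \<theta>] by (simp add: k_def s_def[symmetric] f_def[of \<theta>] field_simps)
  then have "s * h' \<theta>0 - (- x $ 1 * sin \<theta>0 + x $ 2 * cos \<theta>0) = 0"
    using k0 by (intro DERIV_local_min[OF k, of 1]) auto
  then have e1: "s * h' \<theta>0 = - x $ 1 * sin \<theta>0 + x $ 2 * cos \<theta>0" by simp
  have e2: "s * h \<theta>0 = x $ 1 * cos \<theta>0 + x $ 2 * sin \<theta>0"
    using k0 by (simp add: k_def inner_real2)
  have sc: "sin \<theta>0 * sin \<theta>0 + cos \<theta>0 * cos \<theta>0 = 1" using sin_cos_squared_add3 by (simp add: add.commute)
  have "x = s *\<^sub>R touch \<theta>0"
  proof -
    have "s * (h \<theta>0 * cos \<theta>0 - h' \<theta>0 * sin \<theta>0) = (s * h \<theta>0) * cos \<theta>0 - (s * h' \<theta>0) * sin \<theta>0"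
      by (simp add: algebra_simps)
    also have "\<dots> = x $ 1" unfolding e1 e2 using sc by algebra
    finally have 1: "s * (h \<theta>0 * cos \<theta>0 - h' \<theta>0 * sin \<theta>0) = x $ 1" .
    have "s * (h \<theta>0 * sin \<theta>0 + h' \<theta>0 * cos \<theta>0) = (s * h \<theta>0) * sin \<theta>0 + (s * h' \<theta>0) * cos \<theta>0"
      by (simp add: algebra_simps)
    also have "\<dots> = x $ 2" unfolding e1 e2 using sc by algebra
    finally show ?thesis using 1 by (simp add: vec2_eq_iff)
  qed
  with \<open>0 < s\<close> \<open>s \<le> 1\<close> \<theta>0 show ?thesis by (rule that)
qed

text \<open>Pairing the common point with \<open>dir \<theta>'\<close> gives
  \<open>s' * h \<theta>' \<le> s * h \<theta>'\<close>, and symmetrically, so the scales agree.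
  Then \<open>touch \<theta>\<close> attains the support value in direction \<theta>', which the
  strict inequality permits only for angles that differ by full turns.\<close>

lemma touch_scaled_inj:
  assumes "0 < s" "0 < s'" "s *\<^sub>R touch \<theta> = s' *\<^sub>R touch \<theta>'"
    and "- pi \<le> \<theta>" "\<theta> < pi" "- pi \<le> \<theta>'" "\<theta>' < pi"
  shows "s = s' \<and> \<theta> = \<theta>'"
proof -
  have aux: "s' \<le> s" if "0 < s" "0 < s'" "s *\<^sub>R touch \<theta> = s' *\<^sub>R touch \<theta>'" for s s' \<theta> \<theta>'
  proof -
    have "s' * h \<theta>' = s' *\<^sub>R touch \<theta>' \<bullet> dir \<theta>'" by (simp add: touch_inner_dir_self)
    also have "\<dots> = s *\<^sub>R touch \<theta> \<bullet> dir \<theta>'" using that by metis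
    also have "\<dots> \<le> s * h \<theta>'" using touch_inner_dir_le[of \<theta> \<theta>'] \<open>0 < s\<close> by simp
    finally show ?thesis using pos[of \<theta>'] by simp
  qed
  have "s = s'" using aux[of s s' \<theta> \<theta>'] aux[of s' s \<theta>' \<theta>] assms by simp
  then have "touch \<theta> = touch \<theta>'" using assms by simp
  then have "\<not> touch \<theta> \<bullet> dir \<theta>' < h \<theta>'" by (simp add: touch_inner_dir_self)
  then obtain k :: int where k: "\<theta> = \<theta>' + of_int k * (2 * pi)"
    using touch_inner_dir_less by blast
  have "\<bar>of_int k * (2 * pi)\<bar> < 2 * pi" using k assms by linarith
  then have "\<bar>real_of_int k\<bar> < 1" by (simp add: abs_mult)
  then have "k = 0" by linarith
  with k \<open>s = s'\<close> show ?thesis by simp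
qed

text \<open>The map \<open>(s, \<theta>) \<mapsto> s p(\<theta>)\<close>, where \<open>p\<close> is \<open>touch\<close>, parametrizes the body with
  Jacobian \<open>s h (h + h'')\<close>.\<close>

lemma measure_body: "measure lebesgue (support_body h) = 1 / 2 * integral {- pi..pi} (\<lambda>\<theta>. h \<theta> * (h \<theta> + h'' \<theta>))"
proof -
  define I where "I = integral {- pi..pi} (\<lambda>\<theta>. h \<theta> * (h \<theta> + h'' \<theta>))"
  define k where "k \<theta> = h \<theta> * (h \<theta> + h'' \<theta>)" for \<theta>
  \<comment> \<open>The edge \<open>s = 0\<close>, which would collapse to the origin, is left out,
    and each direction is counted once. Hence \<open>g\<close> is injective on \<open>S\<close> and
    its image misses just the origin.\<close>
  define S :: "(real^2) set" where "S = {v. v $ 1 \<in> {0<..1} \<and> v $ 2 \<in> {- pi..<pi}}"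
  define g where "g v = v $ 1 *\<^sub>R touch (v $ 2)" for v :: "real^2"
  \<comment> \<open>In the derivative of \<open>touch\<close> the terms with \<open>h'\<close>
    cancel, which leaves \<open>h + h''\<close> times the unit tangent.\<close>
  define g' where "g' v d = d $ 1 *\<^sub>R touch (v $ 2) + (v $ 1 * d $ 2 * (h (v $ 2) + h'' (v $ 2))) *\<^sub>R
    vector [- sin (v $ 2), cos (v $ 2)]" for v d :: "real^2"
  have cont_k: "continuous_on T k" for T
    unfolding k_def using continuous_on_subset[OF continuous''] by (intro continuous_intros continuous) auto
  have k_pos: "0 < k \<theta>" for \<theta> using pos curvature_pos by (simp add: k_def)
  have meas_k [measurable]: "k \<in> borel_measurable borel"
    by (intro borel_measurable_continuous_onI cont_k)
  have meas_nth [measurable]: "(\<lambda>v::real^2. v $ i) \<in> borel_measurable borel" for i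
    by (intro borel_measurable_continuous_onI continuous_intros)
  have S [measurable]: "S \<in> sets borel"
    unfolding S_def by measurable
  have der: "(g has_derivative g' v) (at v within S)" for v
  proof (rule has_derivative_at_withinI)
    have [derivative_intros]: "((\<lambda>v::real^2. h (v $ i)) has_derivative (\<lambda>d. d $ i * h' (v $ i))) (at v)"
      "((\<lambda>v::real^2. h' (v $ i)) has_derivative (\<lambda>d. d $ i * h'' (v $ i))) (at v)" for i
      by (rule has_derivative_eq_rhs[OF has_derivative_compose[OF bounded_linear_imp_has_derivative[OF bounded_linear_vec_nth]]],
         rule deriv[unfolded has_field_derivative_def] deriv'[unfolded has_field_derivative_def], simp add: mult.commute)+
    have [derivative_intros]: "((\<lambda>v::real^2. v $ i) has_derivative (\<lambda>d. d $ i)) (at v)" for i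
      by (rule bounded_linear_imp_has_derivative[OF bounded_linear_vec_nth])
    show "(g has_derivative g' v) (at v)"
      unfolding g_def touch_def vector2_eq_sum
      by (rule derivative_eq_intros refl)+ (simp add: fun_eq_iff g'_def vec2_eq_iff axis_def algebra_simps)
  qed
  have det: "\<bar>det (matrix (g' v))\<bar> = v $ 1 * k (v $ 2)" if "v \<in> S" for v
  proof -
    have "det (matrix (g' v)) =
        (h (v $ 2) * cos (v $ 2) - h' (v $ 2) * sin (v $ 2)) * (v $ 1 * (h (v $ 2) + h'' (v $ 2)) * cos (v $ 2)) +
        v $ 1 * (h (v $ 2) + h'' (v $ 2)) * sin (v $ 2) * (h (v $ 2) * sin (v $ 2) + h' (v $ 2) * cos (v $ 2))"
      by (simp add: det_2 matrix_def g'_def axis_def)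
    also have "\<dots> = v $ 1 * k (v $ 2)"
      unfolding k_def using sin_cos_squared_add3[of "v $ 2"] by algebra
    finally have "det (matrix (g' v)) = v $ 1 * k (v $ 2)" .
    then show ?thesis using that k_pos by (simp add: S_def less_imp_le)
  qed
  have inj: "inj_on g S"
  proof (rule inj_onI)
    fix v w assume "v \<in> S" "w \<in> S" "g v = g w"
    then show "v = w"
      using touch_scaled_inj[of "v $ 1" "w $ 1" "v $ 2" "w $ 2"] by (simp add: g_def S_def vec2_eq_iff)
  qed
  have img: "g ` S = support_body h - {0}"
  proof
    show "support_body h - {0} \<subseteq> g ` S"
    proof
      fix x assume "x \<in> support_body h - {0}"
      then obtain s \<theta> where "0 < s" "s \<le> 1" "- pi \<le> \<theta>" "\<theta> < pi" "x = s *\<^sub>R touch \<theta>"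
        using body_polar by blast
      then have "x = g (vector [s, \<theta>])" "vector [s, \<theta>] \<in> S" by (simp_all add: g_def S_def)
      then show "x \<in> g ` S" by blast
    qed
    show "g ` S \<subseteq> support_body h - {0}"
    proof (clarsimp simp: g_def S_def support_body_def, intro conjI allI)
      fix v :: "real^2" and \<theta> assume v: "0 < v $ 1" "v $ 1 \<le> 1"
      show "v $ 1 * (touch (v $ 2) \<bullet> dir \<theta>) \<le> h \<theta>"
      proof -
        have "v $ 1 * (touch (v $ 2) \<bullet> dir \<theta>) \<le> v $ 1 * h \<theta>"
          using touch_inner_dir_le v by (intro mult_left_mono) auto
        also have "\<dots> \<le> 1 * h \<theta>" using v pos[of \<theta>] by (intro mult_right_mono) auto
        finally show ?thesis by simp
      qed
      show "touch (v $ 2) \<noteq> 0"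
        using touch_inner_dir_self[of "v $ 2"] pos[of "v $ 2"] by auto
    qed
  qed
  have k_int: "(k has_integral I) {- pi..pi}"
    unfolding I_def k_def[symmetric]
    by (intro integrable_integral integrable_continuous_real cont_k)
  \<comment> \<open>The Jacobian is a function of the scale times a function of the angle, so
    Tonelli splits the integral; the factor 1/2 is the integral of \<open>s\<close> over the unit
    interval.\<close>
  have "((\<lambda>v. \<bar>det (matrix (g' v))\<bar>) has_integral (1 / 2 * I)) S"
  proof -
    have nn1: "(\<integral>\<^sup>+x. ennreal (indicator {0<..1} x * x) \<partial>lborel) = ennreal (1 / 2)"
    proof (rule nn_integral_has_integral_lebesgue)
      have "((\<lambda>x::real. x) has_integral (1 / 2)) {0..1}"
        using ident_has_integral[of 0 "1::real"] by simp
      then show "((\<lambda>x::real. x) has_integral (1 / 2)) {0<..1}"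
        by (rule has_integral_spike_set_eq[THEN iffD1, rotated 2]) (auto intro: negligible_subset[of "{0}"])
    qed auto
    have nn2: "(\<integral>\<^sup>+x. ennreal (indicator {- pi..<pi} x * k x) \<partial>lborel) = ennreal I"
    proof (rule nn_integral_has_integral_lebesgue)
      show "(k has_integral I) {- pi..<pi}"
        using k_int by (rule has_integral_spike_set_eq[THEN iffD1, rotated 2]) (auto intro: negligible_subset[of "{pi}"])
    qed (use k_pos less_imp_le in auto)
    have "(\<integral>\<^sup>+v. ennreal (indicator S v * (v $ 1 * k (v $ 2))) \<partial>lborel) =
      (\<integral>\<^sup>+x. \<integral>\<^sup>+y. ennreal (indicator {0<..1} x * x) * ennreal (indicator {- pi..<pi} y * k y) \<partial>lborel \<partial>lborel)"
      by (subst nn_integral_real2)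
         (auto intro!: nn_integral_cong simp: S_def indicator_def ennreal_mult k_pos less_imp_le)
    also have "\<dots> = ennreal (1 / 2) * ennreal I"
      by (simp add: nn_integral_cmult nn_integral_multc nn1 nn2)
    also have "\<dots> = ennreal (1 / 2 * I)"
      by (rule ennreal_mult'[symmetric]) simp
    finally have "((\<lambda>v. indicator S v * (v $ 1 * k (v $ 2))) has_integral (1 / 2 * I)) UNIV"
      using has_integral_nonneg[OF k_int] k_pos
      by (intro nn_integral_has_integral) (auto simp: S_def indicator_def less_imp_le)
    then have "((\<lambda>v. if v \<in> S then v $ 1 * k (v $ 2) else 0) has_integral (1 / 2 * I)) UNIV"
      by (rule has_integral_eq[rotated]) (simp add: indicator_def)
    then have "((\<lambda>v. v $ 1 * k (v $ 2)) has_integral (1 / 2 * I)) S"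
      by (simp only: has_integral_restrict_UNIV)
    then show ?thesis by (rule has_integral_eq[rotated]) (simp add: det)
  qed
  \<comment> \<open>Change of variables for the injective map \<open>g\<close>; the missing origin
    is negligible.\<close>
  then have "measure lebesgue (g ` S) = 1 / 2 * I"
    using has_measure_differentiable_image[OF _ der inj, of "1 / 2 * I"] by simp
  moreover have "measure lebesgue (support_body h) = measure lebesgue (support_body h - {0})"
  proof (rule measure_negligible_symdiff)
    show "support_body h - {0} \<in> lmeasurable"
      by (intro fmeasurable.Diff lmeasurable_compact compact_body compact_insert compact_empty)
    show "negligible (support_body h - {0} - support_body h \<union> (support_body h - (support_body h - {0})))"
      by (rule negligible_subset[of "{0}"]) auto
  qed
  ultimately show ?thesis by (simp add: img I_def)
qed

end

text \<open>Here \<open>h + h'' = c - (n\<^sup>2 - 1) * a * cos (n * \<theta>)\<close>, so the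
  second hypothesis says precisely that the curvature radius is positive. Since
  \<open>n\<^sup>2 - 1 \<ge> 1\<close> it also yields \<open>\<bar>a\<bar> < c\<close>, hence
  \<open>h > 0\<close>. The constant \<open>c\<close> is kept general to cover parallel
  bodies.\<close>

lemma plane_support_cos:
  fixes n :: nat and a c :: real
  assumes "2 \<le> n" and "((real n)\<^sup>2 - 1) * \<bar>a\<bar> < c"
  shows "plane_support (\<lambda>\<theta>. c + a * cos (real n * \<theta>)) (\<lambda>\<theta>. - a * n * sin (real n * \<theta>)) (\<lambda>\<theta>. - a * (real n)\<^sup>2 * cos (real n * \<theta>))"
proof
  have abs_cos: "\<bar>b * cos x\<bar> \<le> \<bar>b\<bar>" for b x :: real
    using mult_left_mono[OF abs_cos_le_one[of x] abs_ge_zero[of b]] by (simp add: abs_mult)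
  have "2\<^sup>2 \<le> (real n)\<^sup>2" using assms(1) by (intro power_mono) auto
  then have n: "1 \<le> (real n)\<^sup>2 - 1" by simp
  have ac: "\<bar>a\<bar> < c" using mult_right_mono[OF n abs_ge_zero[of a]] assms(2) by simp
  fix \<theta> :: real
  show "((\<lambda>\<theta>. c + a * cos (real n * \<theta>)) has_real_derivative - a * n * sin (real n * \<theta>)) (at \<theta>)"
    by (rule derivative_eq_intros refl | simp)+
  show "((\<lambda>\<theta>. - a * n * sin (real n * \<theta>)) has_real_derivative - a * (real n)\<^sup>2 * cos (real n * \<theta>)) (at \<theta>)"
    by (rule derivative_eq_intros refl | simp add: power2_eq_square)+
  show "continuous_on UNIV (\<lambda>\<theta>. - a * (real n)\<^sup>2 * cos (real n * \<theta>))"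
    by (intro continuous_intros)
  show "c + a * cos (real n * (\<theta> + 2 * pi)) = c + a * cos (real n * \<theta>)"
    using cos.plus_of_nat[of "real n * \<theta>" n] by (simp add: algebra_simps)
  show "0 < c + a * cos (real n * \<theta>)"
    using abs_cos[of a "real n * \<theta>"] ac by linarith
  have "\<bar>((real n)\<^sup>2 - 1) * a * cos (real n * \<theta>)\<bar> \<le> ((real n)\<^sup>2 - 1) * \<bar>a\<bar>"
    using abs_cos[of "((real n)\<^sup>2 - 1) * a" "real n * \<theta>"] n by (simp add: abs_mult)
  then show "0 < c + a * cos (real n * \<theta>) + - a * (real n)\<^sup>2 * cos (real n * \<theta>)"
    using assms(2) by (simp add: algebra_simps)
qed

lemma measure_support_body_cos:
  fixes n :: nat and a c :: real
  assumes "2 \<le> n" and "((real n)\<^sup>2 - 1) * \<bar>a\<bar> < c"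
  shows "measure lebesgue (support_body (\<lambda>\<theta>. c + a * cos (real n * \<theta>))) = pi * (c\<^sup>2 - ((real n)\<^sup>2 - 1) * a\<^sup>2 / 2)"
proof -
  interpret plane_support "\<lambda>\<theta>. c + a * cos (real n * \<theta>)" "\<lambda>\<theta>. - a * n * sin (real n * \<theta>)" "\<lambda>\<theta>. - a * (real n)\<^sup>2 * cos (real n * \<theta>)"
    using assms by (rule plane_support_cos)
  \<comment> \<open>With \<open>x = cos (n * \<theta>)\<close> the integrand is \<open>c\<^sup>2 + c
    * a * (2 - n\<^sup>2) * x - a\<^sup>2 * (n\<^sup>2 - 1) * x\<^sup>2\<close>. \<open>F\<close>
    integrates it termwise, the square by the half-angle formula; the sine terms vanish at both
    ends.\<close>
  define F where "F \<theta> = c\<^sup>2 * \<theta> + c * a * (2 - (real n)\<^sup>2) * sin (real n * \<theta>) / n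
    - a\<^sup>2 * ((real n)\<^sup>2 - 1) * (\<theta> / 2 + sin (2 * real n * \<theta>) / (4 * n))" for \<theta>
  have F: "(F has_real_derivative (c + a * cos (real n * \<theta>)) * (c + a * cos (real n * \<theta>) + - a * (real n)\<^sup>2 * cos (real n * \<theta>))) (at \<theta>)" for \<theta>
  proof -
    have "(F has_real_derivative c\<^sup>2 + c * a * (2 - (real n)\<^sup>2) * cos (real n * \<theta>)
        - a\<^sup>2 * ((real n)\<^sup>2 - 1) * ((1 + cos (2 * real n * \<theta>)) / 2)) (at \<theta>)"
      unfolding F_def using assms(1)
      by (auto intro!: derivative_eq_intros simp: field_simps)
    also have "(1 + cos (2 * real n * \<theta>)) / 2 = (cos (real n * \<theta>))\<^sup>2"
      using cos_double_cos[of "real n * \<theta>"] by (simp add: mult.assoc)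
    finally show ?thesis
      by (rule back_subst[of "\<lambda>D. (F has_real_derivative D) (at \<theta>)"]) algebra
  qed
  have "((\<lambda>\<theta>. (c + a * cos (real n * \<theta>)) * (c + a * cos (real n * \<theta>) + - a * (real n)\<^sup>2 * cos (real n * \<theta>))) has_integral F pi - F (- pi)) {- pi..pi}"
    by (rule fundamental_theorem_of_calculus)
       (simp, unfold has_real_derivative_iff_has_vector_derivative[symmetric], rule has_field_derivative_at_within[OF F])
  then have "measure lebesgue (support_body (\<lambda>\<theta>. c + a * cos (real n * \<theta>))) = 1 / 2 * (F pi - F (- pi))"
    unfolding measure_body by (simp only: integral_unique)
  also have "\<dots> = pi * (c\<^sup>2 - ((real n)\<^sup>2 - 1) * a\<^sup>2 / 2)"
  proof -
    have "sin (n * pi) = 0" "sin (2 * n * pi) = 0"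
      using sin_npi[of "n"] sin_npi[of "2 * n"] by simp_all
    then have F_pi: "F pi = c\<^sup>2 * pi - a\<^sup>2 * ((real n)\<^sup>2 - 1) * (pi / 2)" "F (- pi) = - F pi"
      by (simp_all add: F_def)
    show ?thesis unfolding F_pi by (simp add: field_simps)
  qed
  finally show ?thesis .
qed

section \<open>Parallel bodies in the plane\<close>

definition parallel_body :: "'a::real_normed_vector set \<Rightarrow> real \<Rightarrow> 'a set" where
  "parallel_body K r = {x + y |x y. x \<in> K \<and> y \<in> cball 0 r}"

lemma add_in_parallel_body: "x \<in> K \<Longrightarrow> norm y \<le> r \<Longrightarrow> x + y \<in> parallel_body K r"
  unfolding parallel_body_def by auto

lemma compact_parallel_body: "compact K \<Longrightarrow> compact (parallel_body K r)"
  for K :: "'a::euclidean_space set"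
  unfolding parallel_body_def by (intro compact_sums compact_cball)

lemma convex_body_parallel_body:
  assumes "convex_body K" "0 \<le> r"
  shows "convex_body (parallel_body K r)"
proof -
  have "parallel_body K r = (\<Union>x\<in>K. \<Union>y\<in>cball 0 r. {x + y})"
    by (fastforce simp: parallel_body_def)
  then have "convex (parallel_body K r)"
    using assms by (simp add: convex_body_def convex_sums)
  moreover have "K \<subseteq> parallel_body K r"
    using assms(2) by (force simp: parallel_body_def)
  ultimately show ?thesis
    using assms(1) interior_mono[of K "parallel_body K r"]
    by (auto simp: convex_body_def compact_parallel_body)
qed

lemma support_function_attained:
  assumes "convex_body P"
  obtains x where "x \<in> P" "x \<bullet> dir \<theta> = support_function P \<theta>"
proof -
  have P: "compact P" "P \<noteq> {}" using assms by (auto simp: convex_body_def)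
  have "continuous_on P (\<lambda>x. x \<bullet> dir \<theta>)" by (intro continuous_intros)
  then obtain x where x: "x \<in> P" "\<And>y. y \<in> P \<Longrightarrow> y \<bullet> dir \<theta> \<le> x \<bullet> dir \<theta>"
    using continuous_attains_sup[OF P] by blast
  then have "support_function P \<theta> = x \<bullet> dir \<theta>"
    unfolding support_function_dir by (intro cSup_eq_maximum) auto
  with x(1) show ?thesis by (simp add: that)
qed

lemma inner_dir_le_support_function:
  "convex_body P \<Longrightarrow> x \<in> P \<Longrightarrow> x \<bullet> dir \<theta> \<le> support_function P \<theta>"
  unfolding support_function_dir by (auto simp: convex_body_def intro!: cSUP_upper bdd_above_inner_image)

text \<open>Maximizers add: a farthest point of \<open>P\<close> plus the farthest point
  \<open>r *\<^sub>R dir \<theta>\<close> of the disc is farthest in the sum.\<close>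

lemma support_function_parallel_body:
  assumes "convex_body P" "0 \<le> r"
  shows "support_function (parallel_body P r) = (\<lambda>\<theta>. support_function P \<theta> + r)"
proof
  fix \<theta>
  show "support_function (parallel_body P r) \<theta> = support_function P \<theta> + r"
    unfolding support_function_dir[of "parallel_body P r"]
  proof (rule cSup_eq_maximum)
    obtain x where x: "x \<in> P" "x \<bullet> dir \<theta> = support_function P \<theta>"
      using support_function_attained[OF assms(1)] .
    have "(x + r *\<^sub>R dir \<theta>) \<bullet> dir \<theta> = support_function P \<theta> + r"
      using x by (simp add: inner_add_left power2_norm_eq_inner[symmetric])
    moreover have "x + r *\<^sub>R dir \<theta> \<in> parallel_body P r"
      using x assms by (intro add_in_parallel_body) auto
    ultimately show "support_function P \<theta> + r \<in> (\<lambda>x. x \<bullet> dir \<theta>) ` parallel_body P r"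
      by (metis imageI)
  next
    fix v assume "v \<in> (\<lambda>x. x \<bullet> dir \<theta>) ` parallel_body P r"
    then obtain x y where "x \<in> P" "norm y \<le> r" "v = x \<bullet> dir \<theta> + y \<bullet> dir \<theta>"
      by (auto simp: parallel_body_def inner_add_left)
    then show "v \<le> support_function P \<theta> + r"
      using inner_dir_le_support_function[OF assms(1), of x \<theta>] norm_cauchy_schwarz[of y "dir \<theta>"] by simp
  qed
qed

text \<open>The parallel body is the Wulff shape with constant term \<open>c = 1 + r\<close>.
  Expanding \<open>c\<^sup>2\<close> exhibits the perimeter \<open>2 * pi\<close> as the coefficient
  of \<open>r\<close>.\<close>

lemma measure_parallel_body_cos:
  fixes n :: nat
  assumes "convex_body P" "support_function P = (\<lambda>\<theta>. 1 + a * cos (real n * \<theta>))"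
    and "2 \<le> n" "((real n)\<^sup>2 - 1) * \<bar>a\<bar> < 1" "0 \<le> r"
  shows "measure lebesgue (parallel_body P r) = pi * (1 - ((real n)\<^sup>2 - 1) * a\<^sup>2 / 2) + 2 * pi * r + pi * r\<^sup>2"
proof -
  have "parallel_body P r = support_body (\<lambda>\<theta>. (1 + r) + a * cos (real n * \<theta>))"
    by (subst convex_body_eq_support_body[OF convex_body_parallel_body[OF assms(1,5)]])
       (simp add: support_function_parallel_body assms(1,2,5) add_ac)
  also have "measure lebesgue \<dots> = pi * ((1 + r)\<^sup>2 - ((real n)\<^sup>2 - 1) * a\<^sup>2 / 2)"
    using assms by (intro measure_support_body_cos) auto
  finally show ?thesis by (simp add: power2_eq_square algebra_simps)
qed

section \<open>Steiner formula of a prism\<close>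

lemma emeasure_lborel_compact: "compact S \<Longrightarrow> emeasure lborel S = ennreal (measure lebesgue S)"
  for S :: "'a::euclidean_space set"
proof -
  assume S: "compact S"
  then have "emeasure lborel S \<noteq> \<infinity>"
    using emeasure_bounded_finite[OF compact_imp_bounded[OF S]] by simp
  moreover have "measure lebesgue S = measure lborel S"
    using S by (simp add: compact_imp_closed)
  ultimately show ?thesis by (simp add: emeasure_eq_ennreal_measure)
qed

text \<open>This is the volume of the part of a parallel body that lies above the top face of the
  prism: at height \<open>s\<close> over the face the slice is the parallel body of \<open>P\<close>
  at distance \<open>sqrt (r\<^sup>2 - s\<^sup>2)\<close>.\<close>

lemma half_disc_integral:
  assumes "0 \<le> r"
  shows "((\<lambda>s. A + L * sqrt (r\<^sup>2 - s\<^sup>2) + pi * (r\<^sup>2 - s\<^sup>2)) has_integral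
    (A * r + L * r\<^sup>2 * pi / 4 + 2 * pi * r ^ 3 / 3)) {0..r}"
proof (cases "r = 0")
  case False
  then have r: "0 < r" using assms by simp
  \<comment> \<open>The middle term is the primitive of the half circle: a triangle plus a circular
    sector.\<close>
  define F where "F s = A * s + L / 2 * (s * sqrt (r\<^sup>2 - s\<^sup>2) + r\<^sup>2 * arcsin (s / r)) + pi * (r\<^sup>2 * s - 1 / 3 * s ^ 3)" for s
  have "((\<lambda>s. A + L * sqrt (r\<^sup>2 - s\<^sup>2) + pi * (r\<^sup>2 - s\<^sup>2)) has_integral F r - F 0) {0..r}"
  \<comment> \<open>\<open>sqrt\<close> and \<open>arcsin\<close> are not differentiable at the end
    \<open>s = r\<close>, so derivatives are taken in the interior only.\<close>
  proof (rule fundamental_theorem_of_calculus_interior)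
    show "continuous_on {0..r} F"
      unfolding F_def using r by (intro continuous_intros) (auto simp: divide_le_eq le_divide_eq)
    fix s assume s: "s \<in> {0<..<r}"
    define q where "q = sqrt (r\<^sup>2 - s\<^sup>2)"
    have "s\<^sup>2 < r\<^sup>2" using s by (intro power_strict_mono) auto
    then have q: "0 < q" "q\<^sup>2 = r\<^sup>2 - s\<^sup>2" by (simp_all add: q_def)
    have "sqrt (1 - (s / r)\<^sup>2) = sqrt ((r\<^sup>2 - s\<^sup>2) / r\<^sup>2)"
      using r by (simp add: power_divide diff_divide_distrib)
    also have "\<dots> = q / r" using r by (simp add: real_sqrt_divide q_def)
    finally have e: "sqrt (1 - (s / r)\<^sup>2) = q / r" .
    have "((\<lambda>s. arcsin (s / r)) has_real_derivative inverse (sqrt (1 - (s / r)\<^sup>2)) * (1 / r)) (at s)"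
      by (rule DERIV_chain2[of arcsin], rule DERIV_arcsin) (use s r in \<open>auto intro!: derivative_eq_intros simp: field_simps\<close>)
    then have D1: "((\<lambda>s. arcsin (s / r)) has_real_derivative 1 / q) (at s)"
      using r q by (simp add: e)
    have "((\<lambda>s. sqrt (r\<^sup>2 - s\<^sup>2)) has_real_derivative inverse q / 2 * (- (2 * s))) (at s)"
      unfolding q_def
      by (rule DERIV_chain2[of sqrt], rule DERIV_real_sqrt) (use \<open>s\<^sup>2 < r\<^sup>2\<close> in \<open>auto intro!: derivative_eq_intros\<close>)
    then have D2: "((\<lambda>s. sqrt (r\<^sup>2 - s\<^sup>2)) has_real_derivative - (s / q)) (at s)"
      by (simp add: field_simps)
    have "(F has_real_derivative A + L / 2 * ((q + s * - (s / q)) + r\<^sup>2 * (1 / q)) + pi * (r\<^sup>2 - s\<^sup>2)) (at s)"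
      unfolding F_def
      by (rule D1 D2 DERIV_add DERIV_cmult DERIV_diff DERIV_mult derivative_eq_intros refl)+ (simp add: q_def[symmetric])
    also have "(q + s * - (s / q)) + r\<^sup>2 * (1 / q) = 2 * q"
    proof -
      have "(q + s * - (s / q)) + r\<^sup>2 * (1 / q) = q + (r\<^sup>2 - s\<^sup>2) / q"
        by (simp add: diff_divide_distrib power2_eq_square)
      also have "\<dots> = 2 * q" using q unfolding q(2)[symmetric] using q(1) by (simp add: power2_eq_square)
      finally show ?thesis .
    qed
    finally show "(F has_vector_derivative A + L * sqrt (r\<^sup>2 - s\<^sup>2) + pi * (r\<^sup>2 - s\<^sup>2)) (at s)"
      by (simp add: has_real_derivative_iff_has_vector_derivative[symmetric] q_def)
  qed (use r in simp)
  moreover have "F r - F 0 = A * r + L * r\<^sup>2 * pi / 4 + 2 * pi * r ^ 3 / 3"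
    using r by (simp add: F_def power2_eq_square power3_eq_cube field_simps)
  ultimately show ?thesis by metis
qed (auto intro: has_integral_negligible[of "{0}"])

lemma compact_prism: "compact P \<Longrightarrow> compact (prism P H)"
proof -
  assume P: "compact P"
  have "prism P H = (\<lambda>q. vector [fst q $ 1, fst q $ 2, snd q]) ` (P \<times> {- H / 2..H / 2})"
  proof
    show "prism P H \<subseteq> (\<lambda>q. vector [fst q $ 1, fst q $ 2, snd q]) ` (P \<times> {- H / 2..H / 2})"
    proof
      fix x assume "x \<in> prism P H"
      then show "x \<in> (\<lambda>q. vector [fst q $ 1, fst q $ 2, snd q]) ` (P \<times> {- H / 2..H / 2})"
        by (intro image_eqI[of _ _ "(vector [x $ 1, x $ 2], x $ 3)"]) (auto simp: prism_def vec3_eq_iff)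
    qed
  qed (auto simp: prism_def)
  moreover have "compact ((\<lambda>q :: (real^2) \<times> real. vector [fst q $ 1, fst q $ 2, snd q] :: real^3) ` (P \<times> {- H / 2..H / 2}))"
    by (intro compact_continuous_image compact_Times continuous_intros P compact_Icc)
  ultimately show ?thesis by simp
qed

lemma convex_body_prism:
  assumes "convex_body P" "0 < H"
  shows "convex_body (prism P H)"
proof -
  have "convex (prism P H)"
  proof (rule convexI)
    fix x y and u v :: real
    assume xy: "x \<in> prism P H" "y \<in> prism P H" and uv: "0 \<le> u" "0 \<le> v" "u + v = 1"
    have "vector [(u *\<^sub>R x + v *\<^sub>R y) $ 1, (u *\<^sub>R x + v *\<^sub>R y) $ 2] =
        (u *\<^sub>R vector [x $ 1, x $ 2] + v *\<^sub>R vector [y $ 1, y $ 2] :: real^2)"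
      by (simp add: vec2_eq_iff)
    moreover have "u *\<^sub>R vector [x $ 1, x $ 2] + v *\<^sub>R vector [y $ 1, y $ 2] \<in> P"
      using xy uv assms(1) by (intro convexD) (auto simp: prism_def convex_body_def)
    moreover have "u *\<^sub>R (x $ 3) + v *\<^sub>R (y $ 3) \<in> {- H / 2..H / 2}"
      using xy uv by (intro convexD convex_real_interval) (auto simp: prism_def)
    ultimately show "u *\<^sub>R x + v *\<^sub>R y \<in> prism P H"
      by (simp add: prism_def)
  qed
  moreover have "interior (prism P H) \<noteq> {}"
  proof -
    define U where "U = {x :: real^3. vector [x $ 1, x $ 2] \<in> interior P \<and> x $ 3 \<in> {- H / 2<..<H / 2}}"
    have "U = (\<lambda>x. vector [x $ 1, x $ 2]) -` interior P \<inter> (\<lambda>x. x $ 3) -` {- H / 2<..<H / 2}"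
      by (auto simp: U_def)
    then have "open U"
      by (auto intro!: open_Int open_vimage continuous_intros)
    moreover have "U \<subseteq> prism P H"
      using interior_subset by (fastforce simp: U_def prism_def)
    moreover obtain p where "p \<in> interior P" using assms(1) by (auto simp: convex_body_def)
    then have "vector [p $ 1, p $ 2, 0] \<in> U" using assms(2) by (simp add: U_def)
    ultimately show ?thesis using interior_maximal by blast
  qed
  ultimately show ?thesis
    using assms(1) by (simp add: convex_body_def compact_prism)
qed

text \<open>Going from the prism to height \<open>z\<close> costs at least the vertical distance
  \<open>d\<close> from \<open>z\<close> to the interval of heights. By Pythagoras a horizontal
  displacement of length up to \<open>sqrt (r\<^sup>2 - d\<^sup>2)\<close> remains, and it is used
  up in full when the height in the prism is the nearest one.\<close>

lemma parallel_prism_slice: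
  assumes "0 < H" "0 \<le> r"
  shows "{p :: real^2. vector [p $ 1, p $ 2, z] \<in> parallel_body (prism P H) r} =
    (if \<bar>z\<bar> \<le> H / 2 + r then parallel_body P (sqrt (r\<^sup>2 - (max 0 (\<bar>z\<bar> - H / 2))\<^sup>2)) else {})"
    (is "?S = ?T")
proof -
  define d where "d = max 0 (\<bar>z\<bar> - H / 2)"
  have d0: "0 \<le> d" by (simp add: d_def)
  have norm_split: "(norm y)\<^sup>2 = (norm (vector [y $ 1, y $ 2] :: real^2))\<^sup>2 + (y $ 3)\<^sup>2" for y :: "real^3"
    by (simp add: norm_real2 norm_real3)
  show ?thesis
  proof (intro set_eqI iffI)
    fix p :: "real^2" assume "p \<in> ?S"
    then obtain x y where xy: "vector [p $ 1, p $ 2, z] = x + y" "x \<in> prism P H" "norm y \<le> r"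
      by (auto simp: parallel_body_def)
    then have comp: "p $ 1 = x $ 1 + y $ 1" "p $ 2 = x $ 2 + y $ 2" "z = x $ 3 + y $ 3"
      by (auto simp: vec3_eq_iff)
    have "\<bar>x $ 3\<bar> \<le> H / 2" using xy(2) by (auto simp: prism_def)
    then have "d \<le> \<bar>y $ 3\<bar>" using comp(3) by (simp add: d_def)
    then have "d\<^sup>2 \<le> (y $ 3)\<^sup>2" using d0 by (metis abs_le_square_iff abs_of_nonneg)
    moreover have "(norm y)\<^sup>2 \<le> r\<^sup>2" using xy(3) by (intro power_mono) auto
    ultimately have w: "(norm (vector [y $ 1, y $ 2] :: real^2))\<^sup>2 \<le> r\<^sup>2 - d\<^sup>2"
      using norm_split[of y] by linarith
    then have "d\<^sup>2 \<le> r\<^sup>2" using zero_le_power2[of "norm (vector [y $ 1, y $ 2] :: real^2)"] by linarith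
    then have "d \<le> r" using assms(2) by (rule power2_le_imp_le)
    then have z: "\<bar>z\<bar> \<le> H / 2 + r" by (simp add: d_def)
    have "p = vector [x $ 1, x $ 2] + vector [y $ 1, y $ 2]" using comp by (simp add: vec2_eq_iff)
    then have "p \<in> parallel_body P (sqrt (r\<^sup>2 - d\<^sup>2))"
      using xy(2) w by (auto simp: prism_def intro!: add_in_parallel_body real_le_rsqrt)
    then show "p \<in> ?T" using z by (simp add: d_def)
  next
    fix p assume "p \<in> ?T"
    then have z: "\<bar>z\<bar> \<le> H / 2 + r" and "p \<in> parallel_body P (sqrt (r\<^sup>2 - d\<^sup>2))"
      by (auto simp: d_def split: if_splits)
    then obtain q w where qw: "p = q + w" "q \<in> P" "norm w \<le> sqrt (r\<^sup>2 - d\<^sup>2)"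
      by (auto simp: parallel_body_def)
    have "d \<le> r" using z assms by (simp add: d_def)
    then have "d\<^sup>2 \<le> r\<^sup>2" using d0 by (intro power_mono)
    then have w: "(norm w)\<^sup>2 \<le> r\<^sup>2 - d\<^sup>2"
      using power_mono[OF qw(3), of 2] by simp
    \<comment> \<open>The point of the height interval nearest to \<open>z\<close>.\<close>
    define \<zeta> where "\<zeta> = max (- H / 2) (min (H / 2) z)"
    have \<zeta>: "\<zeta> \<in> {- H / 2..H / 2}" "\<bar>z - \<zeta>\<bar> = d" using assms(1) by (auto simp: \<zeta>_def d_def)
    then have "(z - \<zeta>)\<^sup>2 = d\<^sup>2" by (metis power2_abs)
    then have "(norm (vector [w $ 1, w $ 2, z - \<zeta>] :: real^3))\<^sup>2 \<le> r\<^sup>2"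
      using w by (simp add: norm_split)
    then have "norm (vector [w $ 1, w $ 2, z - \<zeta>] :: real^3) \<le> r"
      using assms(2) by (rule power2_le_imp_le)
    moreover have "vector [q $ 1, q $ 2, \<zeta>] \<in> prism P H"
      using qw(2) \<zeta>(1) by (simp add: prism_def)
    moreover have "vector [p $ 1, p $ 2, z] = (vector [q $ 1, q $ 2, \<zeta>] + vector [w $ 1, w $ 2, z - \<zeta>] :: real^3)"
      using qw(1) by (simp add: vec3_eq_iff)
    ultimately show "p \<in> ?S" by (simp add: add_in_parallel_body)
  qed
qed

text \<open>Integration over the height: the block between the faces contributes \<open>H\<close>
  times the area of the parallel body at distance \<open>r\<close>, and each of the two congruent
  caps contributes \<open>J\<close> from \<open>half_disc_integral\<close>.\<close>

lemma measure_parallel_prism: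
  assumes P: "convex_body P" and H: "0 < H" and r: "0 \<le> r"
    and area: "\<And>s. 0 \<le> s \<Longrightarrow> measure lebesgue (parallel_body P s) = A + L * s + pi * s\<^sup>2"
  shows "measure lebesgue (parallel_body (prism P H) r) =
    A * H + 2 * r * (A + L * H / 2) + pi * r\<^sup>2 * (H + L / 2) + 4 * pi / 3 * r ^ 3"
proof -
  have cP: "compact P" using P by (simp add: convex_body_def)
  define \<phi> where "\<phi> s = A + L * sqrt (r\<^sup>2 - s\<^sup>2) + pi * (r\<^sup>2 - s\<^sup>2)" for s
  define g where "g z = \<phi> (max 0 (\<bar>z\<bar> - H / 2))" for z
  define J where "J = A * r + L * r\<^sup>2 * pi / 4 + 2 * pi * r ^ 3 / 3"
  let ?b = "H / 2 + r"
  have slice: "emeasure lborel {p :: real^2. vector [p $ 1, p $ 2, z] \<in> parallel_body (prism P H) r} =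
      ennreal (indicator {- ?b..?b} z * g z)" and nonneg: "z \<in> {- ?b..?b} \<Longrightarrow> 0 \<le> g z" for z
  proof -
    define s where "s = sqrt (r\<^sup>2 - (max 0 (\<bar>z\<bar> - H / 2))\<^sup>2)"
    have m: "0 \<le> s" "measure lebesgue (parallel_body P s) = g z" if "z \<in> {- ?b..?b}"
    proof -
      have "(max 0 (\<bar>z\<bar> - H / 2))\<^sup>2 \<le> r\<^sup>2" using that r by (intro power_mono) auto
      then show "0 \<le> s" "measure lebesgue (parallel_body P s) = g z"
        by (simp_all add: s_def area g_def \<phi>_def)
    qed
    then show "z \<in> {- ?b..?b} \<Longrightarrow> 0 \<le> g z" by (metis measure_nonneg)
    show "emeasure lborel {p :: real^2. vector [p $ 1, p $ 2, z] \<in> parallel_body (prism P H) r} =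
      ennreal (indicator {- ?b..?b} z * g z)"
      using m by (auto simp: parallel_prism_slice[OF H r] s_def[symmetric]
          emeasure_lborel_compact compact_parallel_body cP indicator_def)
  qed
  have right: "(g has_integral J) {H / 2..?b}"
  proof -
    have "(\<phi> has_integral J) {0..r}"
      unfolding \<phi>_def J_def using r by (rule half_disc_integral)
    then have "((\<lambda>z. \<phi> (z - H / 2)) has_integral J) {H / 2..?b}"
      using has_integral_shift_real_ivl[of \<phi> J 0 r "- (H / 2)"] by (simp add: add_ac)
    then show ?thesis
      by (rule has_integral_eq[rotated]) (use H in \<open>auto simp: g_def intro!: arg_cong[of _ _ \<phi>]\<close>)
  qed
  moreover have g_minus: "g (- z) = g z" for z by (simp add: g_def)
  ultimately have left: "(g has_integral J) {- ?b..- (H / 2)}"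
    using has_integral_reflect_real[of g J ?b "H / 2"] g_minus by simp
  have "((\<lambda>z. A + L * r + pi * r\<^sup>2) has_integral (H * (A + L * r + pi * r\<^sup>2))) {- (H / 2)..H / 2}"
    using has_integral_const_real[of "A + L * r + pi * r\<^sup>2" "- (H / 2)" "H / 2"] H by simp
  then have mid: "(g has_integral (H * (A + L * r + pi * r\<^sup>2))) {- (H / 2)..H / 2}"
  proof (rule has_integral_eq[rotated])
    fix z assume "z \<in> {- (H / 2)..H / 2}"
    then have "max 0 (\<bar>z\<bar> - H / 2) = 0" by auto
    then show "A + L * r + pi * r\<^sup>2 = g z" using r by (simp add: g_def \<phi>_def)
  qed
  define I where "I = J + H * (A + L * r + pi * r\<^sup>2) + J"
  have total: "(g has_integral I) {- ?b..?b}"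
    unfolding I_def
  proof (rule has_integral_combine)
    show "(g has_integral J + H * (A + L * r + pi * r\<^sup>2)) {- ?b..H / 2}"
      by (rule has_integral_combine[OF _ _ left mid]) (use H r in auto)
  qed (use H r right in auto)
  have "emeasure lborel (parallel_body (prism P H) r) = (\<integral>\<^sup>+z. ennreal (indicator {- ?b..?b} z * g z) \<partial>lborel)"
    by (subst emeasure_real3_slices)
       (simp_all only: slice borel_closed compact_imp_closed compact_parallel_body compact_prism cP)
  also have "\<dots> = ennreal I"
    using nonneg total by (rule nn_integral_has_integral_lebesgue)
  finally have "emeasure lborel (parallel_body (prism P H) r) = ennreal I" .
  moreover have "0 \<le> I" using total nonneg by (rule has_integral_nonneg)
  ultimately have "measure lebesgue (parallel_body (prism P H) r) = I"
    by (simp add: emeasure_lborel_compact compact_parallel_body compact_prism cP)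
  also have "I = A * H + 2 * r * (A + L * H / 2) + pi * r\<^sup>2 * (H + L / 2) + 4 * pi / 3 * r ^ 3"
    unfolding I_def J_def by (simp add: field_simps)
  finally show ?thesis .
qed

text \<open>\<open>V 0\<close> is prescribed, radius 0 gives \<open>V 3\<close>, and the radii 1 and
  2 give two independent linear equations for \<open>V 1\<close> and \<open>V 2\<close>. The formula
  says nothing about larger indices, hence the bound on \<open>j\<close>. This makes the description
  in \<open>intrinsic_volume\<close> well defined.\<close>

lemma steiner_formula_unique:
  assumes "steiner_formula K V" "steiner_formula K V'" "j \<le> 3"
  shows "V j = V' j"
proof -
  have 0: "V 0 = V' 0" using assms by (simp add: steiner_formula_def)
  have eq: "V 3 + 2 * r * V 2 + pi * r\<^sup>2 * V 1 + 4 * pi / 3 * r ^ 3 * V 0 =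
      V' 3 + 2 * r * V' 2 + pi * r\<^sup>2 * V' 1 + 4 * pi / 3 * r ^ 3 * V' 0" if "0 \<le> r" for r
    using assms that by (auto simp: steiner_formula_def)
  have 3: "V 3 = V' 3" using eq[of 0] by simp
  have "2 * V 2 + pi * V 1 = 2 * V' 2 + pi * V' 1"
    using eq[of 1] 0 3 by simp
  moreover have "4 * V 2 + pi * 4 * V 1 = 4 * V' 2 + pi * 4 * V' 1"
    using eq[of 2] 0 3 by simp
  ultimately have "pi * V 1 = pi * V' 1" and 2: "V 2 = V' 2" by linarith+
  then have 1: "V 1 = V' 1" by simp
  have "j = 0 \<or> j = 1 \<or> j = 2 \<or> j = 3" using assms(3) by linarith
  then show ?thesis using 0 1 2 3 by auto
qed

lemma intrinsic_volume_eq: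
  assumes "steiner_formula K V" "j \<le> 3"
  shows "intrinsic_volume j K = V j"
  unfolding intrinsic_volume_def
proof (rule the_equality)
  show "\<exists>V'. steiner_formula K V' \<and> V j = V' j" using assms(1) by blast
  fix a assume "\<exists>V'. steiner_formula K V' \<and> a = V' j"
  then show "a = V j" using steiner_formula_unique[OF _ assms] by blast
qed

text \<open>\<open>A\<close> and \<open>L\<close> are the area and the perimeter of
  \<open>P\<close>; comparison of \<open>measure_parallel_prism\<close> with the Steiner
  normalization turns the perimeter into \<open>L / 2\<close>.\<close>

lemma intrinsic_volume_prism:
  assumes P: "convex_body P" and H: "0 < H"
    and area: "\<And>s. 0 \<le> s \<Longrightarrow> measure lebesgue (parallel_body P s) = A + L * s + pi * s\<^sup>2"
  shows "intrinsic_volume 0 (prism P H) = 1"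
    and "intrinsic_volume 1 (prism P H) = L / 2 + H"
    and "intrinsic_volume 2 (prism P H) = A + L / 2 * H"
    and "intrinsic_volume 3 (prism P H) = A * H"
proof -
  define V :: "nat \<Rightarrow> real" where
    "V j = (if j = 0 then 1 else if j = 1 then L / 2 + H else if j = 2 then A + L / 2 * H else A * H)" for j
  have "steiner_formula (prism P H) V"
    unfolding steiner_formula_def parallel_body_def[symmetric]
  proof (intro conjI allI impI)
    fix r :: real assume "0 \<le> r"
    from measure_parallel_prism[OF P H this area]
    show "measure lebesgue (parallel_body (prism P H) r) =
        V 3 + 2 * r * V 2 + pi * r\<^sup>2 * V 1 + 4 * pi / 3 * r ^ 3 * V 0"
      by (simp add: V_def add_ac)
  qed (simp add: V_def)
  note iv = intrinsic_volume_eq[OF this]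
  show "intrinsic_volume 0 (prism P H) = 1" by (subst iv) (simp_all add: V_def)
  show "intrinsic_volume 1 (prism P H) = L / 2 + H" by (subst iv) (simp_all add: V_def)
  show "intrinsic_volume 2 (prism P H) = A + L / 2 * H" by (subst iv) (simp_all add: V_def)
  show "intrinsic_volume 3 (prism P H) = A * H" by (subst iv) (simp_all add: V_def)
qed

section \<open>Uniform distribution on the sphere\<close>

lemma measurable_orthogonal_transformation:
  fixes f :: "'a::euclidean_space \<Rightarrow> 'a"
  assumes "orthogonal_transformation f"
  shows "f \<in> borel_measurable borel"
  using orthogonal_transformation_linear[OF assms]
  by (intro borel_measurable_continuous_onI linear_continuous_on) (simp add: linear_conv_bounded_linear)

text \<open>The preimage is the image under the inverse, which is orthogonal as well; boundedness
  keeps the measures finite.\<close>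

lemma orthogonal_transformation_vimage:
  fixes f :: "real^'n::{finite,wellorder} \<Rightarrow> real^'n::_"
  assumes f: "orthogonal_transformation f" and S: "S \<in> sets borel" "bounded S"
  shows "emeasure lborel (f -` S) = emeasure lborel S"
proof -
  have bij: "bij f" using f by (rule orthogonal_transformation_bij)
  have inv: "orthogonal_transformation (inv f)" using f by (rule orthogonal_transformation_inv)
  have lS: "S \<in> lmeasurable"
    using S by (intro bounded_set_imp_lmeasurable) auto
  have img: "f -` S = inv f ` S" using bij by (simp add: bij_vimage_eq_inv_image)
  note mf = measurable_orthogonal_transformation[OF f]
  have fS: "f -` S \<in> sets borel" using S(1) mf by (metis measurable_sets_borel)
  have "f -` S \<in> lmeasurable" unfolding img using inv lS by (rule measurable_orthogonal_image)
  then have "emeasure lebesgue (f -` S) = ennreal (measure lebesgue (f -` S))"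
    by (rule emeasure_eq_measure2)
  also have "\<dots> = ennreal (measure lebesgue S)"
    unfolding img using inv lS by (simp add: measure_orthogonal_image)
  also have "\<dots> = emeasure lebesgue S" using lS by (rule emeasure_eq_measure2[symmetric])
  finally show ?thesis using S fS by simp
qed

lemma orthogonal_transformation_sgn:
  fixes f :: "'a::euclidean_space \<Rightarrow> 'a"
  assumes "orthogonal_transformation f"
  shows "f (sgn x) = sgn (f x)"
  using assms by (simp add: sgn_div_norm orthogonal_transformation linear_scale)

lemma space_uniform_sphere: "space uniform_sphere = sphere 0 1"
  by (simp add: uniform_sphere_def space_restrict_space)

lemma sets_uniform_sphere: "sets uniform_sphere = sets (restrict_space borel (sphere 0 1))"
  unfolding uniform_sphere_def by (intro sets_restrict_space_cong) simp

lemma measurable_uniform_sphere: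
  "f \<in> borel_measurable borel \<Longrightarrow> f \<in> borel_measurable uniform_sphere"
  by (simp add: measurable_cong_sets[OF sets_uniform_sphere refl] measurable_restrict_space1)

lemma emeasure_uniform_sphere:
  assumes "A \<in> sets borel" "A \<subseteq> sphere 0 1"
  shows "emeasure uniform_sphere A = emeasure lborel (cball 0 1 \<inter> sgn -` A) / emeasure lborel (cball 0 1 :: (real^3) set)"
proof -
  have "emeasure uniform_sphere A = emeasure (distr (uniform_measure lborel (cball 0 1)) borel sgn) A"
    unfolding uniform_sphere_def using assms by (intro emeasure_restrict_space) auto
  also have "\<dots> = emeasure (uniform_measure lborel (cball 0 1)) (sgn -` A)"
    using assms by (subst emeasure_distr) auto
  also have "\<dots> = emeasure lborel (cball 0 1 \<inter> sgn -` A) / emeasure lborel (cball 0 1 :: (real^3) set)"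
    using assms by (intro emeasure_uniform_measure) (auto intro: measurable_sets_borel[OF borel_measurable_sgn])
  finally show ?thesis .
qed

lemma prob_space_uniform_sphere: "prob_space uniform_sphere"
proof
  have 0: "0 < emeasure lborel (cball 0 1 :: (real^3) set)" "emeasure lborel (cball 0 1 :: (real^3) set) < \<infinity>"
    by (simp_all add: emeasure_cball unit_ball_vol_3)
  \<comment> \<open>\<open>sgn\<close> sends the centre to 0, which is off the sphere, so the cone
    over the whole sphere is the punctured ball.\<close>
  have cone: "cball 0 1 \<inter> sgn -` sphere 0 1 = cball 0 1 - {0 :: real^3}"
    by (auto simp: norm_sgn)
  have "emeasure uniform_sphere (sphere 0 1) = emeasure lborel (cball 0 1 - {0 :: real^3}) / emeasure lborel (cball 0 1 :: (real^3) set)"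
    using emeasure_uniform_sphere[of "sphere 0 1"] unfolding cone by simp
  also have "emeasure lborel (cball 0 1 - {0 :: real^3}) = emeasure lborel (cball 0 1 :: (real^3) set)"
    by (rule emeasure_Diff_null_set) (simp_all add: null_sets_def)
  also have "\<dots> / \<dots> = 1" using 0 by (intro ennreal_divide_self) simp_all
  finally show "emeasure uniform_sphere (space uniform_sphere) = 1"
    by (simp only: space_uniform_sphere)
qed

lemma measurable_orthogonal_uniform_sphere:
  assumes f: "orthogonal_transformation f"
  shows "f \<in> uniform_sphere \<rightarrow>\<^sub>M uniform_sphere"
  unfolding measurable_cong_sets[OF sets_uniform_sphere sets_uniform_sphere]
  using f measurable_orthogonal_transformation[OF f]
  by (intro measurable_restrict_space3) (auto simp: orthogonal_transformation)

lemma distr_uniform_sphere: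
  assumes f: "orthogonal_transformation f"
  shows "distr uniform_sphere uniform_sphere f = uniform_sphere"
proof (rule measure_eqI)
  have nf: "norm (f x) = norm x" for x using f by (simp add: orthogonal_transformation)
  note mf = measurable_orthogonal_transformation[OF f]
  fix A assume "A \<in> sets (distr uniform_sphere uniform_sphere f)"
  then have A: "A \<in> sets borel" "A \<subseteq> sphere 0 1" and A': "A \<in> sets uniform_sphere"
    by (auto simp: sets_uniform_sphere sets_restrict_space_iff)
  have fA: "f -` A \<in> sets borel" using A(1) by (metis measurable_sets_borel mf)
  have fA': "f -` A \<subseteq> sphere 0 1" using A(2) by (auto simp: nf subset_iff)
  have "emeasure (distr uniform_sphere uniform_sphere f) A = emeasure uniform_sphere (f -` A \<inter> sphere 0 1)"
    using emeasure_distr[OF measurable_orthogonal_uniform_sphere[OF f] A'] by (simp add: space_uniform_sphere)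
  also have "f -` A \<inter> sphere 0 1 = f -` A" using fA' by auto
  also have "emeasure uniform_sphere (f -` A) =
      emeasure lborel (cball 0 1 \<inter> sgn -` f -` A) / emeasure lborel (cball 0 1 :: (real^3) set)"
    using fA fA' by (rule emeasure_uniform_sphere)
  also have "cball 0 1 \<inter> sgn -` f -` A = f -` (cball 0 1 \<inter> sgn -` A)"
    using f by (auto simp: nf orthogonal_transformation_sgn)
  also have "emeasure lborel (f -` (cball 0 1 \<inter> sgn -` A)) = emeasure lborel (cball 0 1 \<inter> sgn -` A)"
    using A(1) by (intro orthogonal_transformation_vimage f)
       (auto intro: bounded_Int measurable_sets_borel[OF borel_measurable_sgn])
  also have "\<dots> / emeasure lborel (cball 0 1 :: (real^3) set) = emeasure uniform_sphere A"
    using A by (rule emeasure_uniform_sphere[symmetric])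
  finally show "emeasure (distr uniform_sphere uniform_sphere f) A = emeasure uniform_sphere A" .
qed simp

lemma integral_uniform_sphere_orthogonal:
  fixes g :: "real^3 \<Rightarrow> real"
  assumes f: "orthogonal_transformation f" and g: "g \<in> borel_measurable borel"
  shows "(\<integral>u. g (f u) \<partial>uniform_sphere) = (\<integral>u. g u \<partial>uniform_sphere)"
  using integral_distr[OF measurable_orthogonal_uniform_sphere[OF f] measurable_uniform_sphere[OF g]]
  unfolding distr_uniform_sphere[OF f] by (rule sym)

text \<open>As a complex number the horizontal part turns a rotation about the vertical axis into
  multiplication by \<open>cis\<close>, and its powers produce cosines of multiple angles.\<close>

definition horiz :: "real^3 \<Rightarrow> complex" where
  "horiz u = Complex (u $ 1) (u $ 2)"

text \<open>In polar coordinates this is \<open>r cos (n \<theta>)\<close>; at the origin division by zero yields the right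
  value 0.\<close>

definition wave :: "nat \<Rightarrow> complex \<Rightarrow> real" where
  "wave n w = Re (w ^ n) / cmod w ^ (n - 1)"

lemma wave_rcis:
  assumes "0 < n" "0 \<le> r"
  shows "wave n (rcis r \<theta>) = r * cos (n * \<theta>)"
proof (cases "r = 0")
  case False
  have "r ^ n = r * r ^ (n - 1)" using assms(1) by (simp add: power_eq_if)
  then show ?thesis using False assms by (simp add: wave_def DeMoivre2)
qed (use assms in \<open>simp add: wave_def power_0_left\<close>)

lemma wave_cis_mult:
  assumes "0 < n"
  shows "wave n (cis \<phi> * w) = cmod w * cos (n * (Arg w + \<phi>))"
proof -
  have "cis \<phi> * w = rcis (cmod w) (Arg w + \<phi>)"
    by (subst rcis_cmod_Arg[of w, symmetric]) (simp add: rcis_def cis_mult[symmetric] ac_simps)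
  then show ?thesis using assms by (simp add: wave_rcis)
qed

lemma wave_eq: "0 < n \<Longrightarrow> wave n w = cmod w * cos (n * Arg w)"
  using wave_cis_mult[of n 0 w] by simp

text \<open>The rotation shifts the phase \<open>n * \<theta>\<close> by \<pi>.\<close>

lemma wave_rotate_half_period: "0 < n \<Longrightarrow> wave n (cis (pi / n) * w) = - wave n w"
  by (subst wave_cis_mult) (simp_all add: wave_eq distrib_left)

text \<open>The phase shift by \<pi>/2 turns the cosine into minus the sine, and the squares add
  up.\<close>

lemma wave_rotate_quarter_period:
  assumes "0 < n"
  shows "(wave n (cis (pi / (2 * n)) * w))\<^sup>2 + (wave n w)\<^sup>2 = (cmod w)\<^sup>2"
proof -
  have "n * (Arg w + pi / (2 * n)) = n * Arg w + pi / 2"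
    using assms by (simp add: field_simps)
  then have "wave n (cis (pi / (2 * n)) * w) = - cmod w * sin (n * Arg w)"
    using assms by (simp add: wave_cis_mult cos_add)
  then show ?thesis
    using assms by (simp add: wave_eq power_mult_distrib distrib_left[symmetric])
qed

lemma abs_wave_le: "0 < n \<Longrightarrow> \<bar>wave n w\<bar> \<le> cmod w"
  using mult_left_mono[OF abs_cos_le_one[of "n * Arg w"] norm_ge_zero[of w]] by (simp add: wave_eq abs_mult)

lemma borel_measurable_Complex [measurable (raw)]:
  assumes "f \<in> borel_measurable M" "g \<in> borel_measurable M"
  shows "(\<lambda>x. Complex (f x) (g x)) \<in> borel_measurable M"
  unfolding Complex_eq using assms by measurable

lemma measurable_horiz [measurable]: "horiz \<in> borel_measurable borel"
  unfolding horiz_def by measurable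

lemma measurable_wave [measurable]: "wave n \<in> borel_measurable borel"
  unfolding wave_def by measurable

section \<open>Rotations about the vertical axis and second moments on the sphere\<close>

definition rot3 :: "real \<Rightarrow> real^3 \<Rightarrow> real^3" where
  "rot3 \<phi> u = vector [cos \<phi> * u $ 1 - sin \<phi> * u $ 2, sin \<phi> * u $ 1 + cos \<phi> * u $ 2, u $ 3]"

lemma rot3_nth_3 [simp]: "rot3 \<phi> u $ 3 = u $ 3"
  by (simp add: rot3_def)

lemma horiz_rot3: "horiz (rot3 \<phi> u) = cis \<phi> * horiz u"
  by (simp add: horiz_def rot3_def complex_eq_iff)

lemma norm_horiz: "(norm u)\<^sup>2 = (cmod (horiz u))\<^sup>2 + (u $ 3)\<^sup>2"
  by (simp add: norm_real3 cmod_power2 horiz_def)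

lemma orthogonal_transformation_rot3: "orthogonal_transformation (rot3 \<phi>)"
  unfolding orthogonal_transformation
proof (intro conjI allI linearI)
  fix u v :: "real^3" and c :: real
  show "rot3 \<phi> (u + v) = rot3 \<phi> u + rot3 \<phi> v" "rot3 \<phi> (c *\<^sub>R u) = c *\<^sub>R rot3 \<phi> u"
    by (simp_all add: rot3_def vec3_eq_iff algebra_simps)
  have "(norm (rot3 \<phi> u))\<^sup>2 = (norm u)\<^sup>2"
    by (simp add: norm_horiz horiz_rot3 norm_mult)
  then show "norm (rot3 \<phi> u) = norm u" by simp
qed

lemma integral_rot3:
  fixes g :: "real^3 \<Rightarrow> real"
  assumes "g \<in> borel_measurable borel"
  shows "(\<integral>u. g (rot3 \<phi> u) \<partial>uniform_sphere) = (\<integral>u. g u \<partial>uniform_sphere)"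
  using orthogonal_transformation_rot3 assms by (rule integral_uniform_sphere_orthogonal)

lemma integrable_uniform_sphere:
  fixes g :: "real^3 \<Rightarrow> real"
  assumes "g \<in> borel_measurable borel" "\<And>u. norm u = 1 \<Longrightarrow> \<bar>g u\<bar> \<le> B"
  shows "integrable uniform_sphere g"
proof -
  interpret prob_space uniform_sphere by (rule prob_space_uniform_sphere)
  show ?thesis
    using assms by (intro integrable_const_bound[of _ B] measurable_uniform_sphere AE_I2) (auto simp: space_uniform_sphere)
qed

lemma cmod_horiz_le: "cmod (horiz u) \<le> norm u"
  by (rule power2_le_imp_le) (simp_all add: norm_horiz)

text \<open>All factors are bounded by 1 on the sphere. The list covers the terms in the expansion
  of the square in \<open>second_moment_wave\<close>.\<close>

lemma integrable_uniform_sphere_coords: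
  "integrable uniform_sphere (\<lambda>u. (u $ i)\<^sup>2)"
  "0 < n \<Longrightarrow> integrable uniform_sphere (\<lambda>u. (wave n (horiz u))\<^sup>2)"
  "integrable uniform_sphere (\<lambda>u. (cmod (horiz u))\<^sup>2)"
  "integrable uniform_sphere (\<lambda>u. \<bar>u $ 3\<bar> * cmod (horiz u))"
  "0 < n \<Longrightarrow> integrable uniform_sphere (\<lambda>u. \<bar>u $ 3\<bar> * wave n (horiz u))"
  "0 < n \<Longrightarrow> integrable uniform_sphere (\<lambda>u. cmod (horiz u) * wave n (horiz u))"
proof -
  have c: "\<bar>u $ i\<bar> \<le> 1" "cmod (horiz u) \<le> 1" "0 < n \<Longrightarrow> \<bar>wave n (horiz u)\<bar> \<le> 1"
    if "norm u = 1" for u i n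
    using component_le_norm_cart[of u i] cmod_horiz_le[of u] abs_wave_le[of n "horiz u"] that by simp_all
  have prod: "integrable uniform_sphere (\<lambda>u. f u * g u)"
    if [measurable]: "f \<in> borel_measurable borel" "g \<in> borel_measurable borel"
      and bd: "\<And>u. norm u = 1 \<Longrightarrow> \<bar>f u\<bar> \<le> 1" "\<And>u. norm u = 1 \<Longrightarrow> \<bar>g u\<bar> \<le> 1" for f g :: "real^3 \<Rightarrow> real"
  proof (rule integrable_uniform_sphere)
    show "(\<lambda>u. f u * g u) \<in> borel_measurable borel" by measurable
    fix u :: "real^3" assume "norm u = 1"
    from mult_mono[OF bd[OF this]] show "\<bar>f u * g u\<bar> \<le> 1" by (simp add: abs_mult)
  qed
  show "integrable uniform_sphere (\<lambda>u. (u $ i)\<^sup>2)"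
    unfolding power2_eq_square by (rule prod) (simp_all add: c)
  show "0 < n \<Longrightarrow> integrable uniform_sphere (\<lambda>u. (wave n (horiz u))\<^sup>2)"
    unfolding power2_eq_square by (rule prod) (simp_all add: c)
  show "integrable uniform_sphere (\<lambda>u. (cmod (horiz u))\<^sup>2)"
    unfolding power2_eq_square by (rule prod) (simp_all add: c)
  show "integrable uniform_sphere (\<lambda>u. \<bar>u $ 3\<bar> * cmod (horiz u))"
    by (rule prod) (simp_all add: c)
  show "0 < n \<Longrightarrow> integrable uniform_sphere (\<lambda>u. \<bar>u $ 3\<bar> * wave n (horiz u))"
    by (rule prod) (simp_all add: c)
  show "0 < n \<Longrightarrow> integrable uniform_sphere (\<lambda>u. cmod (horiz u) * wave n (horiz u))"
    by (rule prod) (simp_all add: c)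
qed

text \<open>Exchanging two coordinates is orthogonal, so the three integrals agree, and their sum is
  the integral of \<open>(norm u)\<^sup>2 = 1\<close>.\<close>

lemma integral_coord_sq: "(\<integral>u. (u $ i)\<^sup>2 \<partial>uniform_sphere) = 1 / 3"
proof -
  interpret prob_space uniform_sphere by (rule prob_space_uniform_sphere)
  have swap: "(\<integral>u. (u $ i)\<^sup>2 \<partial>uniform_sphere) = (\<integral>u. (u $ 3)\<^sup>2 \<partial>uniform_sphere)" for i
  proof -
    define f :: "real^3 \<Rightarrow> real^3" where "f u = (\<chi> j. u $ Transposition.transpose i 3 j)" for u
    have "orthogonal_transformation f"
      unfolding orthogonal_transformation
    proof (intro conjI allI linearI)
      fix u v :: "real^3" and c :: real
      show "f (u + v) = f u + f v" "f (c *\<^sub>R u) = c *\<^sub>R f u"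
        by (simp_all add: f_def vec_eq_iff)
      have "(\<Sum>j\<in>UNIV. (u $ Transposition.transpose i 3 j)\<^sup>2) = (\<Sum>j\<in>UNIV. (u $ j)\<^sup>2)"
        by (rule sum.reindex_bij_betw) simp
      then show "norm (f u) = norm u" by (simp add: f_def norm_vec_def L2_set_def)
    qed
    from integral_uniform_sphere_orthogonal[OF this, of "\<lambda>u. (u $ 3)\<^sup>2"]
    show ?thesis by (simp add: f_def)
  qed
  have "(\<integral>u. (\<Sum>i\<in>UNIV. (u $ i)\<^sup>2) \<partial>uniform_sphere) = (\<integral>u. 1 \<partial>uniform_sphere)"
    by (intro Bochner_Integration.integral_cong) (auto simp: space_uniform_sphere norm_vec_def L2_set_def)
  then have "(\<Sum>i\<in>(UNIV::3 set). \<integral>u. (u $ i)\<^sup>2 \<partial>uniform_sphere) = 1"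
    by (simp add: Bochner_Integration.integral_sum integrable_uniform_sphere_coords prob_space)
  then show ?thesis using swap[of 1] swap[of 2] swap[of i] unfolding sum_3 by linarith
qed

lemma integral_cmod_horiz_sq: "(\<integral>u. (cmod (horiz u))\<^sup>2 \<partial>uniform_sphere) = 2 / 3"
  by (simp add: cmod_power2 horiz_def integrable_uniform_sphere_coords integral_coord_sq)

text \<open>After rotation by a quarter period the integral \<open>m\<close> satisfies
  \<open>m = 2 / 3 - m\<close>, where \<open>2 / 3\<close> is the integral of
  \<open>(cmod (horiz u))\<^sup>2\<close>.\<close>

lemma integral_wave_sq:
  assumes "0 < n"
  shows "(\<integral>u. (wave n (horiz u))\<^sup>2 \<partial>uniform_sphere) = 1 / 3"
proof -
  let ?\<phi> = "pi / (2 * n)"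
  have rot: "(\<integral>u. (wave n (horiz (rot3 ?\<phi> u)))\<^sup>2 \<partial>uniform_sphere) = (\<integral>u. (wave n (horiz u))\<^sup>2 \<partial>uniform_sphere)"
    by (rule integral_rot3) measurable
  have eq: "(wave n (horiz (rot3 ?\<phi> u)))\<^sup>2 = (cmod (horiz u))\<^sup>2 - (wave n (horiz u))\<^sup>2" for u
    using wave_rotate_quarter_period[OF assms, of "horiz u"] by (simp add: horiz_rot3)
  show ?thesis
    using rot unfolding eq by (simp add: integrable_uniform_sphere_coords assms integral_cmod_horiz_sq)
qed

text \<open>The rotation by half a period fixes the height and the horizontal length and negates the
  wave, so each integral equals its own negative.\<close>

lemma integral_odd_wave:
  assumes "0 < n"
  shows "(\<integral>u. \<bar>u $ 3\<bar> * wave n (horiz u) \<partial>uniform_sphere) = 0"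
    and "(\<integral>u. cmod (horiz u) * wave n (horiz u) \<partial>uniform_sphere) = 0"
proof -
  have "(\<integral>u. \<bar>rot3 (pi / n) u $ 3\<bar> * wave n (horiz (rot3 (pi / n) u)) \<partial>uniform_sphere) =
      (\<integral>u. \<bar>u $ 3\<bar> * wave n (horiz u) \<partial>uniform_sphere)"
    by (rule integral_rot3) measurable
  then show "(\<integral>u. \<bar>u $ 3\<bar> * wave n (horiz u) \<partial>uniform_sphere) = 0"
    by (simp add: horiz_rot3 wave_rotate_half_period assms)
  have "(\<integral>u. cmod (horiz (rot3 (pi / n) u)) * wave n (horiz (rot3 (pi / n) u)) \<partial>uniform_sphere) =
      (\<integral>u. cmod (horiz u) * wave n (horiz u) \<partial>uniform_sphere)"
    by (rule integral_rot3) measurable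
  then show "(\<integral>u. cmod (horiz u) * wave n (horiz u) \<partial>uniform_sphere) = 0"
    by (simp add: horiz_rot3 wave_rotate_half_period assms norm_mult)
qed

text \<open>Common form of both moments: the width has \<open>\<alpha> = H\<close>,
  \<open>\<beta> = 2\<close>, \<open>\<kappa> = 0\<close>, the brightness has the base area,
  \<open>2 * H\<close> and \<open>pi / 2\<close>. Invariance under \<open>rot3 \<kappa>\<close>
  removes the phase. The mixed integral stays unevaluated because it will cancel between the two
  prisms.\<close>

lemma second_moment_wave:
  assumes n: "0 < n"
  shows "(\<integral>u. (\<alpha> * \<bar>u $ 3\<bar> + \<beta> * (cmod (horiz u) + a * wave n (cis \<kappa> * horiz u)))\<^sup>2 \<partial>uniform_sphere) =
    \<alpha>\<^sup>2 / 3 + 2 * \<alpha> * \<beta> * (\<integral>u. \<bar>u $ 3\<bar> * cmod (horiz u) \<partial>uniform_sphere) + \<beta>\<^sup>2 * (2 / 3 + a\<^sup>2 / 3)"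
proof -
  define G where "G u = (\<alpha> * \<bar>u $ 3\<bar> + \<beta> * (cmod (horiz u) + a * wave n (horiz u)))\<^sup>2" for u
  have expand: "G u = \<alpha>\<^sup>2 * (u $ 3)\<^sup>2 + 2 * \<alpha> * \<beta> * (\<bar>u $ 3\<bar> * cmod (horiz u)) + \<beta>\<^sup>2 * (cmod (horiz u))\<^sup>2
      + \<beta>\<^sup>2 * a\<^sup>2 * (wave n (horiz u))\<^sup>2 + 2 * \<alpha> * \<beta> * a * (\<bar>u $ 3\<bar> * wave n (horiz u))
      + 2 * \<beta>\<^sup>2 * a * (cmod (horiz u) * wave n (horiz u))" for u
    unfolding G_def power2_abs[of "u $ 3", symmetric] by algebra
  have "(\<integral>u. G (rot3 \<kappa> u) \<partial>uniform_sphere) = (\<integral>u. G u \<partial>uniform_sphere)"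
    by (rule integral_rot3) (unfold G_def, measurable)
  moreover have "(\<integral>u. G u \<partial>uniform_sphere) =
    \<alpha>\<^sup>2 / 3 + 2 * \<alpha> * \<beta> * (\<integral>u. \<bar>u $ 3\<bar> * cmod (horiz u) \<partial>uniform_sphere) + \<beta>\<^sup>2 * (2 / 3 + a\<^sup>2 / 3)"
    unfolding expand
    by (simp add: integrable_uniform_sphere_coords n integral_coord_sq
        integral_cmod_horiz_sq integral_wave_sq integral_odd_wave distrib_left)
  ultimately show ?thesis
    by (simp add: G_def horiz_rot3 norm_mult)
qed

section \<open>Width and brightness of a prism\<close>

text \<open>The prism is a product, so the horizontal and the vertical term are maximized
  independently, the latter on the face selected by the sign of \<open>z\<close>.\<close>

lemma prism_sup:
  assumes P: "convex_body P" and H: "0 < H" and r: "0 \<le> r"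
  shows "(SUP x\<in>prism P H. vector [r * cos \<theta>, r * sin \<theta>, z] \<bullet> x) = r * support_function P \<theta> + H / 2 * \<bar>z\<bar>"
proof (rule cSup_eq_maximum)
  have inner: "vector [r * cos \<theta>, r * sin \<theta>, z] \<bullet> x = r * (vector [x $ 1, x $ 2] \<bullet> dir \<theta>) + z * x $ 3" for x :: "real^3"
    by (simp add: inner_real3 inner_real2 algebra_simps)
  obtain p where p: "p \<in> P" "p \<bullet> dir \<theta> = support_function P \<theta>"
    using support_function_attained[OF P] .
  have "vector [p $ 1, p $ 2, if z < 0 then - H / 2 else H / 2] \<in> prism P H"
    using p H by (simp add: prism_def)
  moreover have "vector [r * cos \<theta>, r * sin \<theta>, z] \<bullet> (vector [p $ 1, p $ 2, if z < 0 then - H / 2 else H / 2] :: real^3) =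
      r * support_function P \<theta> + H / 2 * \<bar>z\<bar>"
    unfolding inner using p by simp
  ultimately show "r * support_function P \<theta> + H / 2 * \<bar>z\<bar> \<in> (\<bullet>) (vector [r * cos \<theta>, r * sin \<theta>, z]) ` prism P H"
    by (metis imageI)
  fix v assume "v \<in> (\<bullet>) (vector [r * cos \<theta>, r * sin \<theta>, z]) ` prism P H"
  then obtain x where x: "x \<in> prism P H" "v = r * (vector [x $ 1, x $ 2] \<bullet> dir \<theta>) + z * x $ 3"
    by (auto simp: inner)
  have "r * (vector [x $ 1, x $ 2] \<bullet> dir \<theta>) \<le> r * support_function P \<theta>"
    using x(1) r by (intro mult_left_mono inner_dir_le_support_function P) (auto simp: prism_def)
  moreover have "\<bar>z\<bar> * \<bar>x $ 3\<bar> \<le> \<bar>z\<bar> * (H / 2)"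
    using x(1) by (intro mult_left_mono) (auto simp: prism_def)
  then have "z * x $ 3 \<le> H / 2 * \<bar>z\<bar>"
    using abs_ge_self[of "z * x $ 3"] by (simp add: abs_mult mult.commute)
  ultimately show "v \<le> r * support_function P \<theta> + H / 2 * \<bar>z\<bar>" using x(2) by simp
qed

text \<open>The infimum is minus the supremum for the opposite direction, which has angle
  \<open>\<theta> + pi\<close> and height \<open>- z\<close>.\<close>

lemma width_prism:
  assumes P: "convex_body P" and H: "0 < H" and r: "0 \<le> r"
  shows "width (prism P H) (vector [r * cos \<theta>, r * sin \<theta>, z]) =
    r * (support_function P \<theta> + support_function P (\<theta> + pi)) + H * \<bar>z\<bar>"
proof -
  let ?u = "vector [r * cos \<theta>, r * sin \<theta>, z] :: real^3"
  have minus: "- ?u = vector [r * cos (\<theta> + pi), r * sin (\<theta> + pi), - z]"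
    by (simp add: vec3_eq_iff)
  have "(INF x\<in>prism P H. ?u \<bullet> x) = - (SUP x\<in>prism P H. (- ?u) \<bullet> x)"
    by (simp add: Inf_real_def image_image)
  also have "(SUP x\<in>prism P H. (- ?u) \<bullet> x) = r * support_function P (\<theta> + pi) + H / 2 * \<bar>z\<bar>"
    unfolding minus prism_sup[OF P H r] by simp
  finally show ?thesis
    by (simp add: width_def prism_sup[OF P H r] algebra_simps)
qed

text \<open>Any two isometries of the plane onto the same plane in space differ by an orthogonal
  transformation, so every one of them may be used to compute the area.\<close>

lemma plane_area_eq:
  fixes T :: "real^2 \<Rightarrow> real^3"
  assumes T: "linear T" "\<And>y. norm (T y) = norm y" "range T = {x. u \<bullet> x = 0}"
    and S: "T -` S \<in> lmeasurable"
  shows "plane_area u S = measure lebesgue (T -` S)"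
  unfolding plane_area_def
proof (rule the_equality)
  show "\<exists>T' :: real^2 \<Rightarrow> real^3. linear T' \<and> (\<forall>y. norm (T' y) = norm y) \<and>
      range T' = {x. u \<bullet> x = 0} \<and> measure lebesgue (T -` S) = measure lebesgue (T' -` S)"
    using T by blast
  fix a assume "\<exists>T' :: real^2 \<Rightarrow> real^3. linear T' \<and> (\<forall>y. norm (T' y) = norm y) \<and>
      range T' = {x. u \<bullet> x = 0} \<and> a = measure lebesgue (T' -` S)"
  then obtain T' :: "real^2 \<Rightarrow> real^3" where T': "linear T'" "\<And>y. norm (T' y) = norm y"
    "range T' = {x. u \<bullet> x = 0}" "a = measure lebesgue (T' -` S)" by blast
  have inj: "inj T"
    using T(1,2) by (metis linear_injective_0 norm_eq_zero)
  \<comment> \<open>The change of coordinates between the two isometries, well defined because both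
    have the same range.\<close>
  define Q where "Q y = inv T (T' y)" for y
  have TQ: "T (Q y) = T' y" for y
    unfolding Q_def using T(3) T'(3) by (intro f_inv_into_f) auto
  have Q: "orthogonal_transformation Q"
    unfolding orthogonal_transformation
  proof (intro conjI allI linearI)
    show "Q (x + y) = Q x + Q y" for x y
      by (rule injD[OF inj]) (simp add: TQ linear_add[OF T(1)] linear_add[OF T'(1)])
    show "Q (c *\<^sub>R x) = c *\<^sub>R Q x" for c x
      by (rule injD[OF inj]) (simp add: TQ linear_scale[OF T(1)] linear_scale[OF T'(1)])
    show "norm (Q x) = norm x" for x
      using T(2)[of "Q x"] T'(2)[of x] by (simp add: TQ)
  qed
  have "T' -` S = Q -` (T -` S)" by (auto simp: TQ)
  also have "\<dots> = inv Q ` (T -` S)"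
    using orthogonal_transformation_bij[OF Q] by (rule bij_vimage_eq_inv_image)
  finally show "a = measure lebesgue (T -` S)"
    using T'(4) measure_orthogonal_image[OF orthogonal_transformation_inv[OF Q] S] by simp
qed

section \<open>Area of the shadow of a prism\<close>

lemma interval_sum:
  fixes a b c d :: real
  assumes "a \<le> b" "c \<le> d"
  shows "{x + y |x y. x \<in> {a..b} \<and> y \<in> {c..d}} = {a + c..b + d}"
proof
  show "{a + c..b + d} \<subseteq> {x + y |x y. x \<in> {a..b} \<and> y \<in> {c..d}}"
  proof
    fix v assume v: "v \<in> {a + c..b + d}"
    \<comment> \<open>The first summand is the least element of the first interval for which the
      remainder does not exceed \<open>d\<close>.\<close>
    have "v = max a (v - d) + (v - max a (v - d))" by simp
    moreover have "max a (v - d) \<in> {a..b}" "v - max a (v - d) \<in> {c..d}" using v assms by auto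
    ultimately show "v \<in> {x + y |x y. x \<in> {a..b} \<and> y \<in> {c..d}}" by blast
  qed
qed force

text \<open>Lengths of intervals add under Minkowski sums. A negative \<open>s\<close> swaps the
  ends of the scaled interval, hence the absolute value.\<close>

lemma emeasure_scaled_interval_sum:
  fixes a b s r H :: real
  assumes "a \<le> b" "0 \<le> r" "0 \<le> H"
  shows "emeasure lborel {s * q + r * \<zeta> |q \<zeta>. q \<in> {a..b} \<and> \<zeta> \<in> {- H / 2..H / 2}} =
    ennreal (\<bar>s\<bar> * (b - a) + r * H)"
proof -
  obtain a' b' where ab: "times s ` {a..b} = {a'..b'}" "a' \<le> b'" "b' - a' = \<bar>s\<bar> * (b - a)"
  proof (cases "0 \<le> s")
    case True
    then show ?thesis
      using image_affinity_atLeastAtMost[of s 0 a b] mult_left_mono[OF assms(1) True] assms(1)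
      by (intro that[of "s * a" "s * b"]) (simp_all add: algebra_simps)
  next
    case False
    then show ?thesis
      using image_affinity_atLeastAtMost[of s 0 a b] mult_left_mono_neg[OF assms(1), of s] assms(1)
      by (intro that[of "s * b" "s * a"]) (simp_all add: algebra_simps)
  qed
  have cd: "times r ` {- H / 2..H / 2} = {- (r * H / 2)..r * H / 2}"
    using assms image_affinity_atLeastAtMost[of r 0 "- H / 2" "H / 2"] by simp
  have "{s * q + r * \<zeta> |q \<zeta>. q \<in> {a..b} \<and> \<zeta> \<in> {- H / 2..H / 2}} =
      {x + y |x y. x \<in> times s ` {a..b} \<and> y \<in> times r ` {- H / 2..H / 2}}"
    by blast
  also have "\<dots> = {a' + - (r * H / 2)..b' + r * H / 2}"
    unfolding ab cd using ab(2) assms by (intro interval_sum) auto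
  also have "emeasure lborel \<dots> = ennreal (\<bar>s\<bar> * (b - a) + r * H)"
    using ab mult_nonneg_nonneg[OF assms(2,3)] by (subst emeasure_lborel_Icc) (auto simp: algebra_simps)
  finally show ?thesis .
qed

text \<open>Orthonormal coordinates adapted to a viewing direction with horizontal angle \<theta>.
  The first axis is perpendicular to it because the shadow will be sliced at constant first
  coordinate.\<close>

definition frame2 :: "real \<Rightarrow> real^2 \<Rightarrow> real^2" where
  "frame2 \<theta> y = y $ 1 *\<^sub>R dir (\<theta> + pi / 2) + y $ 2 *\<^sub>R dir \<theta>"

lemma frame2_nth:
  "frame2 \<theta> y $ 1 = y $ 2 * cos \<theta> - y $ 1 * sin \<theta>"
  "frame2 \<theta> y $ 2 = y $ 1 * cos \<theta> + y $ 2 * sin \<theta>"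
  by (simp_all add: frame2_def cos_add sin_add)

lemma orthogonal_transformation_frame2: "orthogonal_transformation (frame2 \<theta>)"
  unfolding orthogonal_transformation
proof (intro conjI allI linearI)
  fix u v :: "real^2" and c :: real
  show "frame2 \<theta> (u + v) = frame2 \<theta> u + frame2 \<theta> v" "frame2 \<theta> (c *\<^sub>R u) = c *\<^sub>R frame2 \<theta> u"
    by (simp_all add: frame2_def algebra_simps)
  have "(frame2 \<theta> u $ 1)\<^sup>2 + (frame2 \<theta> u $ 2)\<^sup>2 = (u $ 1)\<^sup>2 + (u $ 2)\<^sup>2"
    unfolding frame2_nth using sin_cos_squared_add[of \<theta>] by algebra
  then show "norm (frame2 \<theta> u) = norm u" by (simp add: norm_real2)
qed

lemma frame2_inner: "frame2 \<theta> (vector [x \<bullet> dir (\<theta> + pi / 2), x \<bullet> dir \<theta>]) = x"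
proof -
  have "(x $ 1 * cos \<theta> + x $ 2 * sin \<theta>) * cos \<theta> - (x $ 2 * cos \<theta> - x $ 1 * sin \<theta>) * sin \<theta> = x $ 1"
    "(x $ 2 * cos \<theta> - x $ 1 * sin \<theta>) * cos \<theta> + (x $ 1 * cos \<theta> + x $ 2 * sin \<theta>) * sin \<theta> = x $ 2"
    using sin_cos_squared_add[of \<theta>] by algebra+
  then show ?thesis by (simp add: vec2_eq_iff frame2_nth inner_real2 cos_add sin_add)
qed

lemma inner_frame2: "frame2 \<theta> y \<bullet> dir (\<theta> + pi / 2) = y $ 1" "frame2 \<theta> y \<bullet> dir \<theta> = y $ 2"
proof -
  have "(y $ 1 * cos \<theta> + y $ 2 * sin \<theta>) * cos \<theta> - (y $ 2 * cos \<theta> - y $ 1 * sin \<theta>) * sin \<theta> = y $ 1"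
    "(y $ 2 * cos \<theta> - y $ 1 * sin \<theta>) * cos \<theta> + (y $ 1 * cos \<theta> + y $ 2 * sin \<theta>) * sin \<theta> = y $ 2"
    using sin_cos_squared_add[of \<theta>] by algebra+
  then show "frame2 \<theta> y \<bullet> dir (\<theta> + pi / 2) = y $ 1" "frame2 \<theta> y \<bullet> dir \<theta> = y $ 2"
    by (simp_all add: frame2_nth inner_real2 cos_add sin_add)
qed

text \<open>\<open>W\<close> is the shadow of the prism in coordinates of the projection plane, with
  \<open>s\<close> up to sign the vertical component of the direction. Its slice at \<tau> is a
  chord of \<open>P\<close> scaled by \<open>s\<close> plus a vertical edge scaled by
  \<open>r\<close>. Integrating the lengths gives \<open>\<bar>s\<bar>\<close> times the area of
  \<open>P\<close> and \<open>r * H\<close> times its width perpendicular to the direction.\<close>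

lemma measure_sheared_prism:
  fixes P :: "(real^2) set" and H r s \<theta> :: real
  assumes P: "convex_body P" and H: "0 < H" and r: "0 \<le> r"
  defines "W \<equiv> {vector [p \<bullet> dir (\<theta> + pi / 2), s * (p \<bullet> dir \<theta>) + r * \<zeta>] |p \<zeta>. p \<in> P \<and> \<zeta> \<in> {- H / 2..H / 2}} :: (real^2) set"
  shows "compact W"
    and "measure lebesgue W = \<bar>s\<bar> * measure lebesgue P +
      r * H * (support_function P (\<theta> + pi / 2) + support_function P (\<theta> - pi / 2))"
proof -
  have cP: "compact P" and vP: "convex P" and nP: "P \<noteq> {}"
    using P by (auto simp: convex_body_def)
  \<comment> \<open>\<open>R\<close> is \<open>P\<close> in frame coordinates,
    \<open>L \<tau>\<close> its chord at first coordinate \<tau>, and \<open>D\<close> the set of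
    all \<tau> whose chord is nonempty.\<close>
  define R where "R = frame2 \<theta> -` P"
  define L where "L \<tau> = {q. vector [\<tau>, q] \<in> R}" for \<tau>
  define D where "D = (\<lambda>p. p \<bullet> dir (\<theta> + pi / 2)) ` P"
  have "W = (\<lambda>q. vector [fst q \<bullet> dir (\<theta> + pi / 2), s * (fst q \<bullet> dir \<theta>) + r * snd q]) ` (P \<times> {- H / 2..H / 2})"
    unfolding W_def by force
  then show cW: "compact W"
    by (auto intro!: compact_continuous_image compact_Times continuous_intros cP)
  have orth: "orthogonal_transformation (frame2 \<theta>)" by (rule orthogonal_transformation_frame2)
  have nf: "norm (frame2 \<theta> y) = norm y" for y using orth by (simp add: orthogonal_transformation)
  have lin: "linear (frame2 \<theta>)" using orth by (rule orthogonal_transformation_linear)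
  have cont: "continuous_on S (frame2 \<theta>)" for S
    using lin by (simp add: linear_continuous_on linear_conv_bounded_linear)
  have closed_R: "closed R"
    unfolding R_def using cP cont by (intro closed_vimage) (auto intro: compact_imp_closed simp: continuous_on_eq_continuous_at)
  have convex_R: "convex R" unfolding R_def using lin vP by (rule convex_linear_vimage)
  obtain B where B: "\<And>p. p \<in> P \<Longrightarrow> norm p \<le> B" using compact_imp_bounded[OF cP] by (auto simp: bounded_iff)
  have norm_R: "norm y \<le> B" if "y \<in> R" for y using that B[of "frame2 \<theta> y"] by (simp add: R_def nf)
  have compact_R: "compact R"
    using closed_R norm_R by (auto simp: compact_eq_bounded_closed bounded_iff)
  have R_eq: "vector [\<tau>, q] \<in> R \<longleftrightarrow> (\<exists>p\<in>P. p \<bullet> dir (\<theta> + pi / 2) = \<tau> \<and> p \<bullet> dir \<theta> = q)" for \<tau> q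
  proof
    assume "vector [\<tau>, q] \<in> R"
    then show "\<exists>p\<in>P. p \<bullet> dir (\<theta> + pi / 2) = \<tau> \<and> p \<bullet> dir \<theta> = q"
      by (intro bexI[of _ "frame2 \<theta> (vector [\<tau>, q])"]) (auto simp: R_def inner_frame2)
  next
    assume "\<exists>p\<in>P. p \<bullet> dir (\<theta> + pi / 2) = \<tau> \<and> p \<bullet> dir \<theta> = q"
    then show "vector [\<tau>, q] \<in> R" using frame2_inner by (auto simp: R_def)
  qed
  \<comment> \<open>A chord is compact and convex, hence a closed interval, possibly empty.\<close>
  have L_interval: "\<exists>a b. L \<tau> = {a..b}" for \<tau>
  proof -
    have "closed (L \<tau>)"
      unfolding L_def using closed_R
      by (intro closed_vimage[unfolded vimage_def]) (auto intro!: continuous_intros)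
    moreover have "\<bar>q\<bar> \<le> B" if "q \<in> L \<tau>" for q
      using that norm_R[of "vector [\<tau>, q]"] component_le_norm_cart[of "vector [\<tau>, q] :: real^2" 2]
      by (simp add: L_def)
    then have "bounded (L \<tau>)" by (auto simp: bounded_iff)
    moreover have "convex (L \<tau>)"
    proof (rule convexI)
      fix x y a b :: real assume xy: "x \<in> L \<tau>" "y \<in> L \<tau>" and ab: "0 \<le> a" "0 \<le> b" "a + b = 1"
      have "a *\<^sub>R vector [\<tau>, x] + b *\<^sub>R vector [\<tau>, y] \<in> R"
        using xy ab by (intro convexD[OF convex_R]) (auto simp: L_def)
      also have "a *\<^sub>R vector [\<tau>, x] + b *\<^sub>R vector [\<tau>, y] = (vector [\<tau>, a *\<^sub>R x + b *\<^sub>R y] :: real^2)"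
        using ab by (simp add: vec2_eq_iff distrib_right[symmetric])
      finally show "a *\<^sub>R x + b *\<^sub>R y \<in> L \<tau>" by (simp add: L_def)
    qed
    ultimately show ?thesis
      using connected_compact_interval_1[of "L \<tau>"] by (auto simp: compact_eq_bounded_closed convex_connected)
  qed
  have D_iff: "\<tau> \<in> D \<longleftrightarrow> L \<tau> \<noteq> {}" for \<tau>
    by (auto simp: D_def L_def R_eq)
  have D_eq: "D = {- support_function P (\<theta> - pi / 2)..support_function P (\<theta> + pi / 2)}"
  proof -
    have dir_minus: "dir (\<theta> - pi / 2) = - dir (\<theta> + pi / 2)"
      by (simp add: vec2_eq_iff cos_add sin_add cos_diff sin_diff)
    have "connected D" "compact D"
      unfolding D_def
      by (intro connected_continuous_image compact_continuous_image continuous_intros convex_connected cP vP)+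
    then obtain a b where ab: "D = {a..b}"
      using connected_compact_interval_1[of D] by auto
    obtain p where p: "p \<in> P" "p \<bullet> dir (\<theta> + pi / 2) = support_function P (\<theta> + pi / 2)"
      using support_function_attained[OF P] .
    obtain p' where p': "p' \<in> P" "p' \<bullet> dir (\<theta> - pi / 2) = support_function P (\<theta> - pi / 2)"
      using support_function_attained[OF P] .
    have "support_function P (\<theta> + pi / 2) \<in> D"
      unfolding D_def using p by (intro image_eqI[of _ _ p]) simp_all
    moreover have "- support_function P (\<theta> - pi / 2) \<in> D"
      unfolding D_def using p' by (intro image_eqI[of _ _ p']) (simp_all add: dir_minus)
    moreover have "v \<le> support_function P (\<theta> + pi / 2)" "- support_function P (\<theta> - pi / 2) \<le> v" if "v \<in> D" for v
      using that inner_dir_le_support_function[OF P, of _ "\<theta> + pi / 2"]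
        inner_dir_le_support_function[OF P, of _ "\<theta> - pi / 2"]
      by (fastforce simp: D_def dir_minus)+
    ultimately show ?thesis unfolding ab by (auto simp: order.antisym)
  qed
  have nonneg: "0 \<le> support_function P (\<theta> + pi / 2) + support_function P (\<theta> - pi / 2)"
    using nP D_def D_eq by auto
  \<comment> \<open>The edge contributes its full length as soon as the chord is nonempty, even if
    it is a single point; hence the indicator of \<open>D\<close>.\<close>
  have slice: "emeasure lborel {y. vector [\<tau>, y] \<in> W} =
      ennreal \<bar>s\<bar> * emeasure lborel (L \<tau>) + ennreal (r * H) * indicator D \<tau>" for \<tau>
  proof -
    have "{y. vector [\<tau>, y] \<in> W} = {s * q + r * \<zeta> |q \<zeta>. q \<in> L \<tau> \<and> \<zeta> \<in> {- H / 2..H / 2}}" (is "?S = _")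
    proof -
      have "y \<in> ?S \<longleftrightarrow> (\<exists>p \<zeta>. p \<in> P \<and> \<zeta> \<in> {- H / 2..H / 2} \<and> p \<bullet> dir (\<theta> + pi / 2) = \<tau> \<and> y = s * (p \<bullet> dir \<theta>) + r * \<zeta>)" for y
        by (auto simp: W_def vec2_eq_iff)
      then show ?thesis by (fastforce simp: L_def R_eq)
    qed
    moreover obtain a b where "L \<tau> = {a..b}" using L_interval by blast
    ultimately show ?thesis
    proof (cases "a \<le> b")
      case True
      then have "\<tau> \<in> D" using \<open>L \<tau> = {a..b}\<close> by (simp add: D_iff)
      with True show ?thesis
        using \<open>?S = _\<close> emeasure_scaled_interval_sum[OF True r, of H s] H r
        by (simp add: \<open>L \<tau> = {a..b}\<close> ennreal_mult ennreal_plus)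
    next
      case False
      then have "\<tau> \<notin> D" "L \<tau> = {}" using \<open>L \<tau> = {a..b}\<close> by (simp_all add: D_iff)
      then show ?thesis using \<open>?S = _\<close> by simp
    qed
  qed
  have [measurable]: "(\<lambda>\<tau>. emeasure lborel (L \<tau>)) \<in> borel_measurable borel"
    unfolding L_def using closed_R by (intro measurable_emeasure_real2_slice) auto
  have [measurable]: "D \<in> sets borel" by (simp add: D_eq)
  have "emeasure lborel W = (\<integral>\<^sup>+\<tau>. emeasure lborel {y. vector [\<tau>, y] \<in> W} \<partial>lborel)"
    using cW by (intro emeasure_real2_slices) (simp add: compact_imp_closed)
  also have "\<dots> = ennreal \<bar>s\<bar> * (\<integral>\<^sup>+\<tau>. emeasure lborel (L \<tau>) \<partial>lborel) + ennreal (r * H) * emeasure lborel D"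
    unfolding slice by (simp add: nn_integral_add nn_integral_cmult)
  also have "(\<integral>\<^sup>+\<tau>. emeasure lborel (L \<tau>) \<partial>lborel) = emeasure lborel R"
    unfolding L_def using closed_R by (intro emeasure_real2_slices[symmetric]) simp
  also have "emeasure lborel R = emeasure lborel P"
    unfolding R_def using cP by (intro orthogonal_transformation_vimage orth) (auto simp: compact_imp_bounded compact_imp_closed)
  also have "ennreal \<bar>s\<bar> * emeasure lborel P + ennreal (r * H) * emeasure lborel D =
      ennreal (\<bar>s\<bar> * measure lebesgue P + r * H * (support_function P (\<theta> + pi / 2) + support_function P (\<theta> - pi / 2)))"
    using nonneg H r by (simp add: emeasure_lborel_compact cP D_eq ennreal_mult ennreal_plus)
  finally have "ennreal (measure lebesgue W) =
      ennreal (\<bar>s\<bar> * measure lebesgue P + r * H * (support_function P (\<theta> + pi / 2) + support_function P (\<theta> - pi / 2)))"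
    by (simp only: emeasure_lborel_compact[OF cW])
  then show "measure lebesgue W = \<bar>s\<bar> * measure lebesgue P +
      r * H * (support_function P (\<theta> + pi / 2) + support_function P (\<theta> - pi / 2))"
    using nonneg H r by (subst (asm) ennreal_inj) simp_all
qed

lemma brightness_prism:
  assumes P: "convex_body P" and H: "0 < H" and r: "0 \<le> r" and unit: "r\<^sup>2 + z\<^sup>2 = 1"
  shows "brightness (prism P H) (vector [r * cos \<theta>, r * sin \<theta>, z]) =
    \<bar>z\<bar> * measure lebesgue P + r * H * (support_function P (\<theta> + pi / 2) + support_function P (\<theta> - pi / 2))"
proof -
  define u :: "real^3" where "u = vector [r * cos \<theta>, r * sin \<theta>, z]"
  \<comment> \<open>The images of the unit vectors are the horizontal unit vector perpendicular to
    \<open>u\<close> and the unit vector that completes it and \<open>u\<close> to an orthonormal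
    basis.\<close>
  define T :: "real^2 \<Rightarrow> real^3" where
    "T y = vector [- y $ 1 * sin \<theta> - y $ 2 * z * cos \<theta>, y $ 1 * cos \<theta> - y $ 2 * z * sin \<theta>, y $ 2 * r]" for y
  define C :: "real^3 \<Rightarrow> real^2" where
    "C x = vector [x $ 2 * cos \<theta> - x $ 1 * sin \<theta>, - z * (x $ 1 * cos \<theta> + x $ 2 * sin \<theta>) + r * x $ 3]" for x
  have sc: "(sin \<theta>)\<^sup>2 + (cos \<theta>)\<^sup>2 = 1" by simp
  have proj: "x - (u \<bullet> x) *\<^sub>R u = T (C x)" for x
  proof -
    have "x $ 1 - (r * cos \<theta> * x $ 1 + r * sin \<theta> * x $ 2 + z * x $ 3) * (r * cos \<theta>) =
        - (x $ 2 * cos \<theta> - x $ 1 * sin \<theta>) * sin \<theta> - (- z * (x $ 1 * cos \<theta> + x $ 2 * sin \<theta>) + r * x $ 3) * z * cos \<theta>"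
      "x $ 2 - (r * cos \<theta> * x $ 1 + r * sin \<theta> * x $ 2 + z * x $ 3) * (r * sin \<theta>) =
        (x $ 2 * cos \<theta> - x $ 1 * sin \<theta>) * cos \<theta> - (- z * (x $ 1 * cos \<theta> + x $ 2 * sin \<theta>) + r * x $ 3) * z * sin \<theta>"
      "x $ 3 - (r * cos \<theta> * x $ 1 + r * sin \<theta> * x $ 2 + z * x $ 3) * z =
        (- z * (x $ 1 * cos \<theta> + x $ 2 * sin \<theta>) + r * x $ 3) * r"
      using sc unit by algebra+
    then show ?thesis by (simp add: vec3_eq_iff inner_real3 u_def T_def C_def)
  qed
  have CT: "C (T y) = y" for y
  proof -
    have "(y $ 1 * cos \<theta> - y $ 2 * z * sin \<theta>) * cos \<theta> - (- y $ 1 * sin \<theta> - y $ 2 * z * cos \<theta>) * sin \<theta> = y $ 1"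
      "- z * ((- y $ 1 * sin \<theta> - y $ 2 * z * cos \<theta>) * cos \<theta> + (y $ 1 * cos \<theta> - y $ 2 * z * sin \<theta>) * sin \<theta>) + r * (y $ 2 * r) = y $ 2"
      using sc unit by algebra+
    then show ?thesis by (simp add: vec2_eq_iff T_def C_def)
  qed
  have uT: "u \<bullet> T y = 0" for y
  proof -
    have "r * cos \<theta> * (- y $ 1 * sin \<theta> - y $ 2 * z * cos \<theta>) + r * sin \<theta> * (y $ 1 * cos \<theta> - y $ 2 * z * sin \<theta>) + z * (y $ 2 * r) = 0"
      using sc by algebra
    then show ?thesis by (simp add: inner_real3 u_def T_def)
  qed
  have lin: "linear T"
    by (intro linearI) (simp_all add: T_def vec3_eq_iff algebra_simps)
  have norm_T: "norm (T y) = norm y" for y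
  proof -
    have "(- y $ 1 * sin \<theta> - y $ 2 * z * cos \<theta>)\<^sup>2 + (y $ 1 * cos \<theta> - y $ 2 * z * sin \<theta>)\<^sup>2 + (y $ 2 * r)\<^sup>2 = (y $ 1)\<^sup>2 + (y $ 2)\<^sup>2"
      using sc unit by algebra
    then show ?thesis by (simp add: norm_real2 norm_real3 T_def)
  qed
  have range_T: "range T = {x. u \<bullet> x = 0}"
  proof
    show "{x. u \<bullet> x = 0} \<subseteq> range T"
    proof
      fix x assume "x \<in> {x. u \<bullet> x = 0}"
      then have "x = T (C x)" using proj[of x] by simp
      then show "x \<in> range T" by blast
    qed
  qed (auto simp: uT)
  define W :: "(real^2) set" where
    "W = {vector [p \<bullet> dir (\<theta> + pi / 2), - z * (p \<bullet> dir \<theta>) + r * \<zeta>] |p \<zeta>. p \<in> P \<and> \<zeta> \<in> {- H / 2..H / 2}}"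
  \<comment> \<open>Since \<open>C\<close> inverts \<open>T\<close> and the projection is
    \<open>T\<close> after \<open>C\<close>, pulling the shadow back along \<open>T\<close> amounts
    to applying \<open>C\<close>.\<close>
  have "T -` ((\<lambda>x. x - (u \<bullet> x) *\<^sub>R u) ` prism P H) = C ` prism P H"
    unfolding proj by (auto simp: image_iff) (metis CT)+
  also have "\<dots> = W"
  proof
    show "C ` prism P H \<subseteq> W"
    proof
      fix y assume "y \<in> C ` prism P H"
      then obtain x where x: "x \<in> prism P H" "y = C x" by blast
      then have "y = vector [vector [x $ 1, x $ 2] \<bullet> dir (\<theta> + pi / 2), - z * (vector [x $ 1, x $ 2] \<bullet> dir \<theta>) + r * x $ 3]"
        by (simp add: C_def inner_real2 cos_add sin_add vec2_eq_iff)
      then show "y \<in> W" using x(1) unfolding W_def prism_def by blast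
    qed
    show "W \<subseteq> C ` prism P H"
    proof
      fix y assume "y \<in> W"
      then obtain p \<zeta> where p: "p \<in> P" "\<zeta> \<in> {- H / 2..H / 2}"
        "y = vector [p \<bullet> dir (\<theta> + pi / 2), - z * (p \<bullet> dir \<theta>) + r * \<zeta>]"
        unfolding W_def by blast
      then have "y = C (vector [p $ 1, p $ 2, \<zeta>])"
        by (simp add: C_def inner_real2 cos_add sin_add vec2_eq_iff)
      then show "y \<in> C ` prism P H" using p by (simp add: prism_def)
    qed
  qed
  finally have TW: "T -` ((\<lambda>x. x - (u \<bullet> x) *\<^sub>R u) ` prism P H) = W" .
  have W: "compact W" "measure lebesgue W = \<bar>- z\<bar> * measure lebesgue P +
      r * H * (support_function P (\<theta> + pi / 2) + support_function P (\<theta> - pi / 2))"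
    unfolding W_def by (rule measure_sheared_prism[OF P H r])+
  have "brightness (prism P H) u = measure lebesgue W"
    unfolding brightness_def using plane_area_eq[OF lin norm_T range_T] W(1)
    by (simp add: TW lmeasurable_compact)
  then show ?thesis using W(2) by (simp add: u_def)
qed

section \<open>Prisms over bodies with trigonometric support function\<close>

text \<open>The Wulff shape is such a body, and each convex body is the Wulff shape of its support
  function.\<close>

lemma ex1_convex_body_cos:
  fixes n :: nat and a :: real
  assumes "2 \<le> n" and "((real n)\<^sup>2 - 1) * \<bar>a\<bar> < 1"
  shows "\<exists>!P. convex_body P \<and> support_function P = (\<lambda>\<theta>. 1 + a * cos (real n * \<theta>))"
proof -
  interpret plane_support "\<lambda>\<theta>. 1 + a * cos (real n * \<theta>)" "\<lambda>\<theta>. - a * n * sin (real n * \<theta>)"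
    "\<lambda>\<theta>. - a * (real n)\<^sup>2 * cos (real n * \<theta>)"
    using assms by (rule plane_support_cos)
  show ?thesis
  proof (rule ex1I)
    show "convex_body (support_body (\<lambda>\<theta>. 1 + a * cos (real n * \<theta>))) \<and>
        support_function (support_body (\<lambda>\<theta>. 1 + a * cos (real n * \<theta>))) = (\<lambda>\<theta>. 1 + a * cos (real n * \<theta>))"
      using convex_body_support_body support_function_body by blast
    show "P = support_body (\<lambda>\<theta>. 1 + a * cos (real n * \<theta>))"
      if "convex_body P \<and> support_function P = (\<lambda>\<theta>. 1 + a * cos (real n * \<theta>))" for P
      using convex_body_eq_support_body[of P] that by metis
  qed
qed

text \<open>For even \<open>n\<close> the support function has period \<pi>, so \<open>P\<close> is
  symmetric about the origin and its width in a direction is twice the support value.\<close>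

locale cos_prism =
  fixes n :: nat and a H :: real and P :: "(real^2) set"
  assumes even: "even n" and n: "2 \<le> n"
    and small: "((real n)\<^sup>2 - 1) * \<bar>a\<bar> < 1"
    and convex_body: "convex_body P"
    and support: "support_function P = (\<lambda>\<theta>. 1 + a * cos (real n * \<theta>))"
    and H: "0 < H"
begin

definition area :: real where
  "area = pi * (1 - ((real n)\<^sup>2 - 1) * a\<^sup>2 / 2)"

lemma P_eq: "P = support_body (\<lambda>\<theta>. 1 + a * cos (real n * \<theta>))"
  using convex_body_eq_support_body[OF convex_body] by (simp only: support)

lemma measure_P: "measure lebesgue P = area"
  using measure_support_body_cos[OF n small] by (simp only: P_eq[symmetric] area_def) simp

lemma support_pi: "support_function P (\<theta> + pi) = support_function P \<theta>"
proof -
  obtain k where k: "n = 2 * k" using even by (elim evenE)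
  have "cos (real n * (\<theta> + pi)) = cos (real n * \<theta> + real k * (2 * pi))"
    by (simp add: k algebra_simps)
  also have "\<dots> = cos (real n * \<theta>)"
    using cos.plus_of_nat[of "real n * \<theta>" k] by (simp add: mult.commute)
  finally show ?thesis by (simp add: support)
qed

lemma uminus_P: "- x \<in> P" if "x \<in> P"
proof -
  have "- x \<bullet> dir \<theta> \<le> support_function P \<theta>" for \<theta>
  proof -
    have "- x \<bullet> dir \<theta> = x \<bullet> dir (\<theta> + pi)" by (simp add: inner_real2)
    also have "\<dots> \<le> support_function P (\<theta> + pi)"
      using convex_body that by (rule inner_dir_le_support_function)
    finally show ?thesis by (simp only: support_pi)
  qed
  then have "- x \<in> support_body (support_function P)" by (simp add: support_body_def)
  then show ?thesis by (simp only: convex_body_eq_support_body[OF convex_body, symmetric])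
qed

lemma centrally_symmetric_prism: "centrally_symmetric (prism P H)"
proof -
  have "vector [- x $ 1, - x $ 2] = - (vector [x $ 1, x $ 2] :: real^2)" for x :: "real^3"
    by (simp add: vec2_eq_iff)
  then have minus: "- x \<in> prism P H" if "x \<in> prism P H" for x
    using that uminus_P[of "vector [x $ 1, x $ 2]"] by (auto simp: prism_def)
  have "(\<lambda>x. 2 *\<^sub>R 0 - x) ` prism P H = prism P H"
  proof
    show "prism P H \<subseteq> (\<lambda>x. 2 *\<^sub>R 0 - x) ` prism P H"
      using minus by (auto intro!: image_eqI[of _ _ "- x" for x])
  qed (use minus in auto)
  then show ?thesis unfolding centrally_symmetric_def by blast
qed

lemmas convex_body_prism = convex_body_prism[OF convex_body H]

lemma intrinsic_volumes:
  "intrinsic_volume 0 (prism P H) = 1"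
  "intrinsic_volume 1 (prism P H) = pi + H"
  "intrinsic_volume 2 (prism P H) = area + pi * H"
  "intrinsic_volume 3 (prism P H) = area * H"
proof -
  have "measure lebesgue (parallel_body P r) = area + 2 * pi * r + pi * r\<^sup>2" if "0 \<le> r" for r
    using measure_parallel_body_cos[OF convex_body support n small that] by (simp only: area_def)
  note iv = intrinsic_volume_prism[OF convex_body H this]
  show "intrinsic_volume 0 (prism P H) = 1" "intrinsic_volume 1 (prism P H) = pi + H"
    "intrinsic_volume 2 (prism P H) = area + pi * H" "intrinsic_volume 3 (prism P H) = area * H"
    using iv by simp_all
qed

lemma cylindrical:
  obtains \<theta> where "u = vector [cmod (horiz u) * cos \<theta>, cmod (horiz u) * sin \<theta>, u $ 3]"
    and "horiz u = rcis (cmod (horiz u)) \<theta>"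
proof -
  have "horiz u = rcis (cmod (horiz u)) (Arg (horiz u))" by (simp add: rcis_cmod_Arg)
  moreover from this have "u $ 1 = cmod (horiz u) * cos (Arg (horiz u))" "u $ 2 = cmod (horiz u) * sin (Arg (horiz u))"
    by (metis horiz_def complex.sel(1) Re_rcis, metis horiz_def complex.sel(2) Im_rcis)
  ultimately show ?thesis by (intro that[of "Arg (horiz u)"]) (auto simp: vec3_eq_iff)
qed

text \<open>The trivial rotation \<open>cis 0\<close> brings the width to the form of
  \<open>second_moment_wave\<close>.\<close>

lemma width_eq: "width (prism P H) u = H * \<bar>u $ 3\<bar> + 2 * (cmod (horiz u) + a * wave n (cis 0 * horiz u))"
proof -
  obtain \<theta> where u: "u = vector [cmod (horiz u) * cos \<theta>, cmod (horiz u) * sin \<theta>, u $ 3]"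
    and hu: "horiz u = rcis (cmod (horiz u)) \<theta>" by (rule cylindrical)
  have "wave n (horiz u) = cmod (horiz u) * cos (real n * \<theta>)"
    using n by (subst hu) (simp add: wave_rcis)
  moreover have "width (prism P H) u = cmod (horiz u) * (2 * (1 + a * cos (real n * \<theta>))) + H * \<bar>u $ 3\<bar>"
    using width_prism[OF convex_body H norm_ge_zero, of "horiz u" \<theta> "u $ 3"] u
    by (simp only: support_pi) (simp add: support)
  ultimately show ?thesis by (simp add: algebra_simps)
qed

text \<open>The quarter turn \<open>cis (pi / 2)\<close> appears because the shadow of the side
  faces sees the width of \<open>P\<close> perpendicular to the horizontal part of
  \<open>u\<close>.\<close>

lemma brightness_eq:
  assumes "norm u = 1"
  shows "brightness (prism P H) u =
    area * \<bar>u $ 3\<bar> + (2 * H) * (cmod (horiz u) + a * wave n (cis (pi / 2) * horiz u))"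
proof -
  obtain \<theta> where u: "u = vector [cmod (horiz u) * cos \<theta>, cmod (horiz u) * sin \<theta>, u $ 3]"
    and hu: "horiz u = rcis (cmod (horiz u)) \<theta>" by (rule cylindrical)
  have "cis (pi / 2) * horiz u = rcis (cmod (horiz u)) (\<theta> + pi / 2)"
    by (subst hu) (simp add: complex_eq_iff cos_add sin_add)
  then have wave: "wave n (cis (pi / 2) * horiz u) = cmod (horiz u) * cos (real n * (\<theta> + pi / 2))"
    using n by (simp add: wave_rcis)
  have "support_function P (\<theta> - pi / 2) = support_function P (\<theta> + pi / 2)"
    using support_pi[of "\<theta> - pi / 2"] by (simp add: add.commute)
  then have "brightness (prism P H) u =
      \<bar>u $ 3\<bar> * area + cmod (horiz u) * H * (2 * support_function P (\<theta> + pi / 2))"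
    using brightness_prism[OF convex_body H norm_ge_zero, of "horiz u" "u $ 3" \<theta>] u norm_horiz[of u] assms
    by (simp add: measure_P)
  then show ?thesis by (simp only: support wave) (simp add: algebra_simps)
qed

lemma measurable_width: "width (prism P H) \<in> borel_measurable uniform_sphere"
  unfolding width_eq[abs_def] by (intro measurable_uniform_sphere) measurable

text \<open>\<open>brightness_eq\<close> is available for unit vectors only, which suffices because
  the sphere is the sample space.\<close>

lemma measurable_brightness: "brightness (prism P H) \<in> borel_measurable uniform_sphere"
proof -
  have "(\<lambda>u. area * \<bar>u $ 3\<bar> + (2 * H) * (cmod (horiz u) + a * wave n (cis (pi / 2) * horiz u)))
      \<in> borel_measurable uniform_sphere"
    by (intro measurable_uniform_sphere) measurable
  then show ?thesis
    by (rule measurable_cong[THEN iffD2, rotated]) (simp add: space_uniform_sphere brightness_eq)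
qed

lemma integral_width_sq:
  "(\<integral>u. (width (prism P H) u)\<^sup>2 \<partial>uniform_sphere) =
    H\<^sup>2 / 3 + 2 * H * 2 * (\<integral>u. \<bar>u $ 3\<bar> * cmod (horiz u) \<partial>uniform_sphere) + 2\<^sup>2 * (2 / 3 + a\<^sup>2 / 3)"
  unfolding width_eq using n by (intro second_moment_wave) auto

lemma integral_brightness_sq:
  "(\<integral>u. (brightness (prism P H) u)\<^sup>2 \<partial>uniform_sphere) =
    area\<^sup>2 / 3 + 2 * area * (2 * H) * (\<integral>u. \<bar>u $ 3\<bar> * cmod (horiz u) \<partial>uniform_sphere) +
    (2 * H)\<^sup>2 * (2 / 3 + a\<^sup>2 / 3)"
proof -
  have "(\<integral>u. (brightness (prism P H) u)\<^sup>2 \<partial>uniform_sphere) =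
      (\<integral>u. (area * \<bar>u $ 3\<bar> + (2 * H) * (cmod (horiz u) + a * wave n (cis (pi / 2) * horiz u)))\<^sup>2 \<partial>uniform_sphere)"
    by (intro Bochner_Integration.integral_cong) (simp_all add: space_uniform_sphere brightness_eq)
  also have "\<dots> = area\<^sup>2 / 3 + 2 * area * (2 * H) * (\<integral>u. \<bar>u $ 3\<bar> * cmod (horiz u) \<partial>uniform_sphere) +
      (2 * H)\<^sup>2 * (2 / 3 + a\<^sup>2 / 3)"
    using n by (intro second_moment_wave) auto
  finally show ?thesis .
qed

text \<open>The second moment is a function of the law alone, so different moments will separate the
  laws.\<close>

lemma second_moment_width_law: "(\<integral>x. x\<^sup>2 \<partial>width_law (prism P H)) = (\<integral>u. (width (prism P H) u)\<^sup>2 \<partial>uniform_sphere)"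
  unfolding width_law_def by (rule integral_distr[OF measurable_width]) measurable

lemma second_moment_brightness_law:
  "(\<integral>x. x\<^sup>2 \<partial>brightness_law (prism P H)) = (\<integral>u. (brightness (prism P H) u)\<^sup>2 \<partial>uniform_sphere)"
  unfolding brightness_law_def by (rule integral_distr[OF measurable_brightness]) measurable

end

section \<open>Comparison of the two prisms\<close>

theorem theorem9p2:
  fixes t H :: real
  assumes "0 < t" and "t < 1 / (3 * sqrt 5)" and "0 < H"
  shows "(\<exists>!P1. convex_body P1 \<and> support_function P1 = (\<lambda>\<theta>. 1 + t * cos (2 * \<theta>))) \<and>
    (\<exists>!P2. convex_body P2 \<and> support_function P2 = (\<lambda>\<theta>. 1 + t / sqrt 5 * cos (4 * \<theta>))) \<and>
    (\<forall>P1 P2 K1 K2 A.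
      convex_body P1 \<and> support_function P1 = (\<lambda>\<theta>. 1 + t * cos (2 * \<theta>)) \<and>
      convex_body P2 \<and> support_function P2 = (\<lambda>\<theta>. 1 + t / sqrt 5 * cos (4 * \<theta>)) \<and>
      K1 = prism P1 H \<and> K2 = prism P2 H \<and> A = pi * (1 - 3 / 2 * t\<^sup>2) \<longrightarrow>
      (\<forall>K\<in>{K1, K2}. convex_body K \<and> centrally_symmetric K \<and>
         intrinsic_volume 3 K = A * H \<and>
         intrinsic_volume 2 K = A + pi * H \<and>
         intrinsic_volume 1 K = pi + H) \<and>
      (\<forall>j\<le>3. intrinsic_volume j K1 = intrinsic_volume j K2) \<and>
      (\<integral>u. (width K1 u)\<^sup>2 \<partial>uniform_sphere) - (\<integral>u. (width K2 u)\<^sup>2 \<partial>uniform_sphere)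
        = 16 / 15 * t\<^sup>2 \<and>
      16 / 15 * t\<^sup>2 > 0 \<and>
      (\<integral>u. (brightness K1 u)\<^sup>2 \<partial>uniform_sphere) - (\<integral>u. (brightness K2 u)\<^sup>2 \<partial>uniform_sphere)
        = 16 / 15 * H\<^sup>2 * t\<^sup>2 \<and>
      16 / 15 * H\<^sup>2 * t\<^sup>2 > 0) \<and>
    \<not> (\<forall>K L :: (real^3) set.
         convex_body K \<and> centrally_symmetric K \<and> convex_body L \<and> centrally_symmetric L \<and>
         (\<forall>j\<in>{1, 2, 3}. intrinsic_volume j K = intrinsic_volume j L) \<longrightarrow>
         width_law K = width_law L) \<and>
    \<not> (\<forall>K L :: (real^3) set.
         convex_body K \<and> centrally_symmetric K \<and> convex_body L \<and> centrally_symmetric L \<and>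
         (\<forall>j\<in>{1, 2, 3}. intrinsic_volume j K = intrinsic_volume j L) \<longrightarrow>
         brightness_law K = brightness_law L)"
proof -
  \<comment> \<open>For \<open>n = 2\<close> the curvature condition is \<open>3 * t < 1\<close>,
    weaker than the assumption on \<open>t\<close>.\<close>
  have "t < 1 / (3 * 1)"
    using assms(2) by (rule order_less_le_trans) (intro divide_left_mono mult_left_mono; simp)
  then have small1: "((real 2)\<^sup>2 - 1) * \<bar>t\<bar> < 1" using assms(1) by simp
  \<comment> \<open>For \<open>n = 4\<close> the condition is \<open>15 * t / sqrt 5 < 1\<close>,
    that is \<open>3 * sqrt 5 * t < 1\<close>, which is the assumption on \<open>t\<close>
    itself.\<close>
  have "15 * t = 3 * t * (sqrt 5 * sqrt 5)" by simp
  also have "\<dots> = sqrt 5 * (t * (3 * sqrt 5))" by (simp only: mult_ac)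
  also have "\<dots> < sqrt 5 * 1"
    using assms(2) by (intro mult_strict_left_mono) (simp_all add: pos_less_divide_eq)
  finally have small2: "((real 4)\<^sup>2 - 1) * \<bar>t / sqrt 5\<bar> < 1" using assms(1) by simp
  have cp1: "cos_prism 2 t H P" if "convex_body P" "support_function P = (\<lambda>\<theta>. 1 + t * cos (2 * \<theta>))" for P
    using that small1 assms(3) by unfold_locales simp_all
  have cp2: "cos_prism 4 (t / sqrt 5) H P" if "convex_body P" "support_function P = (\<lambda>\<theta>. 1 + t / sqrt 5 * cos (4 * \<theta>))" for P
    using that small2 assms(3) by unfold_locales simp_all
  have ex1: "\<exists>!P1. convex_body P1 \<and> support_function P1 = (\<lambda>\<theta>. 1 + t * cos (2 * \<theta>))"
    using ex1_convex_body_cos[OF _ small1] by simp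
  have ex2: "\<exists>!P2. convex_body P2 \<and> support_function P2 = (\<lambda>\<theta>. 1 + t / sqrt 5 * cos (4 * \<theta>))"
    using ex1_convex_body_cos[OF _ small2] by simp
  define A where "A = pi * (1 - 3 / 2 * t\<^sup>2)"
  have area1: "cos_prism.area 2 t = A" if "cos_prism 2 t H P" for P
    unfolding cos_prism.area_def[OF that] A_def by simp
  \<comment> \<open>The amplitude \<open>t / sqrt 5\<close> is chosen such that
    \<open>15 * (t / sqrt 5)\<^sup>2 = 3 * t\<^sup>2\<close>, the value for the first body.\<close>
  have area2: "cos_prism.area 4 (t / sqrt 5) = A" if "cos_prism 4 (t / sqrt 5) H P" for P
    unfolding cos_prism.area_def[OF that] A_def by (simp add: power_divide)
  have bodies: "convex_body K \<and> centrally_symmetric K \<and> intrinsic_volume 0 K = 1 \<and> intrinsic_volume 3 K = A * H \<and>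
      intrinsic_volume 2 K = A + pi * H \<and> intrinsic_volume 1 K = pi + H"
    if "cos_prism 2 t H P \<or> cos_prism 4 (t / sqrt 5) H P" "K = prism P H" for P K
    using that(1)
  proof
    assume cp: "cos_prism 2 t H P"
    then interpret cos_prism 2 t H P .
    show ?thesis
      using convex_body_prism centrally_symmetric_prism intrinsic_volumes area1[OF cp] that(2) by simp
  next
    assume cp: "cos_prism 4 (t / sqrt 5) H P"
    then interpret cos_prism 4 "t / sqrt 5" H P .
    show ?thesis
      using convex_body_prism centrally_symmetric_prism intrinsic_volumes area2[OF cp] that(2) by simp
  qed
  \<comment> \<open>The only terms in which the second moments differ; the factor
    \<open>\<beta>\<^sup>2\<close>, which is 4 or \<open>4 * H\<^sup>2\<close>, turns 4/15 into
    16/15.\<close>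
  have gap: "2 / 3 + t\<^sup>2 / 3 - (2 / 3 + (t / sqrt 5)\<^sup>2 / 3) = 4 / 15 * t\<^sup>2"
    by (simp add: power_divide)
  have width_gap: "(\<integral>u. (width (prism P1 H) u)\<^sup>2 \<partial>uniform_sphere) - (\<integral>u. (width (prism P2 H) u)\<^sup>2 \<partial>uniform_sphere) = 16 / 15 * t\<^sup>2"
    if "cos_prism 2 t H P1" "cos_prism 4 (t / sqrt 5) H P2" for P1 P2
    unfolding cos_prism.integral_width_sq[OF that(1)] cos_prism.integral_width_sq[OF that(2)]
    using gap by (simp add: algebra_simps)
  have brightness_gap: "(\<integral>u. (brightness (prism P1 H) u)\<^sup>2 \<partial>uniform_sphere) - (\<integral>u. (brightness (prism P2 H) u)\<^sup>2 \<partial>uniform_sphere) = 16 / 15 * H\<^sup>2 * t\<^sup>2"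
    if "cos_prism 2 t H P1" "cos_prism 4 (t / sqrt 5) H P2" for P1 P2
  proof -
    have "(2 * H)\<^sup>2 * (2 / 3 + t\<^sup>2 / 3) - (2 * H)\<^sup>2 * (2 / 3 + (t / sqrt 5)\<^sup>2 / 3) = (2 * H)\<^sup>2 * (4 / 15 * t\<^sup>2)"
      unfolding right_diff_distrib[symmetric] gap ..
    then show ?thesis
      unfolding cos_prism.integral_brightness_sq[OF that(1)] cos_prism.integral_brightness_sq[OF that(2)]
        area1[OF that(1)] area2[OF that(2)]
      by simp
  qed
  have pos: "0 < 16 / 15 * t\<^sup>2" "0 < 16 / 15 * H\<^sup>2 * t\<^sup>2" using assms by simp_all
  obtain P1 where "convex_body P1" "support_function P1 = (\<lambda>\<theta>. 1 + t * cos (2 * \<theta>))" using ex1 by blast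
  then have c1: "cos_prism 2 t H P1" by (rule cp1)
  obtain P2 where "convex_body P2" "support_function P2 = (\<lambda>\<theta>. 1 + t / sqrt 5 * cos (4 * \<theta>))" using ex2 by blast
  then have c2: "cos_prism 4 (t / sqrt 5) H P2" by (rule cp2)
  have b1: "cos_prism 2 t H P1 \<or> cos_prism 4 (t / sqrt 5) H P1" and b2: "cos_prism 2 t H P2 \<or> cos_prism 4 (t / sqrt 5) H P2"
    using c1 c2 by blast+
  have witnesses: "convex_body (prism P1 H) \<and> centrally_symmetric (prism P1 H) \<and>
      convex_body (prism P2 H) \<and> centrally_symmetric (prism P2 H) \<and>
      (\<forall>j\<in>{1, 2, 3}. intrinsic_volume j (prism P1 H) = intrinsic_volume j (prism P2 H))"
    using bodies[OF b1 refl] bodies[OF b2 refl] by simp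
  have width_laws: "width_law (prism P1 H) \<noteq> width_law (prism P2 H)"
  proof
    assume "width_law (prism P1 H) = width_law (prism P2 H)"
    then have "(\<integral>u. (width (prism P1 H) u)\<^sup>2 \<partial>uniform_sphere) = (\<integral>u. (width (prism P2 H) u)\<^sup>2 \<partial>uniform_sphere)"
      using cos_prism.second_moment_width_law[OF c1] cos_prism.second_moment_width_law[OF c2] by metis
    then show False using width_gap[OF c1 c2] pos by linarith
  qed
  have brightness_laws: "brightness_law (prism P1 H) \<noteq> brightness_law (prism P2 H)"
  proof
    assume "brightness_law (prism P1 H) = brightness_law (prism P2 H)"
    then have "(\<integral>u. (brightness (prism P1 H) u)\<^sup>2 \<partial>uniform_sphere) = (\<integral>u. (brightness (prism P2 H) u)\<^sup>2 \<partial>uniform_sphere)"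
      using cos_prism.second_moment_brightness_law[OF c1] cos_prism.second_moment_brightness_law[OF c2] by metis
    then show False using brightness_gap[OF c1 c2] pos by linarith
  qed
  show ?thesis
  proof (intro conjI)
    show "\<forall>P1 P2 K1 K2 A.
      convex_body P1 \<and> support_function P1 = (\<lambda>\<theta>. 1 + t * cos (2 * \<theta>)) \<and>
      convex_body P2 \<and> support_function P2 = (\<lambda>\<theta>. 1 + t / sqrt 5 * cos (4 * \<theta>)) \<and>
      K1 = prism P1 H \<and> K2 = prism P2 H \<and> A = pi * (1 - 3 / 2 * t\<^sup>2) \<longrightarrow>
      (\<forall>K\<in>{K1, K2}. convex_body K \<and> centrally_symmetric K \<and>
         intrinsic_volume 3 K = A * H \<and>
         intrinsic_volume 2 K = A + pi * H \<and>
         intrinsic_volume 1 K = pi + H) \<and>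
      (\<forall>j\<le>3. intrinsic_volume j K1 = intrinsic_volume j K2) \<and>
      (\<integral>u. (width K1 u)\<^sup>2 \<partial>uniform_sphere) - (\<integral>u. (width K2 u)\<^sup>2 \<partial>uniform_sphere)
        = 16 / 15 * t\<^sup>2 \<and>
      16 / 15 * t\<^sup>2 > 0 \<and>
      (\<integral>u. (brightness K1 u)\<^sup>2 \<partial>uniform_sphere) - (\<integral>u. (brightness K2 u)\<^sup>2 \<partial>uniform_sphere)
        = 16 / 15 * H\<^sup>2 * t\<^sup>2 \<and>
      16 / 15 * H\<^sup>2 * t\<^sup>2 > 0"
      (is "\<forall>P1 P2 K1 K2 A. ?hyp P1 P2 K1 K2 A \<longrightarrow> ?concl K1 K2 A")
    proof (intro allI impI)
      fix P1 P2 K1 K2 A' assume hyp: "?hyp P1 P2 K1 K2 A'"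
      then have c1: "cos_prism 2 t H P1" and c2: "cos_prism 4 (t / sqrt 5) H P2"
        and K: "K1 = prism P1 H" "K2 = prism P2 H" and A': "A' = A"
        using cp1 cp2 by (auto simp: A_def)
      have K1: "convex_body K1 \<and> centrally_symmetric K1 \<and> intrinsic_volume 0 K1 = 1 \<and> intrinsic_volume 3 K1 = A * H \<and>
          intrinsic_volume 2 K1 = A + pi * H \<and> intrinsic_volume 1 K1 = pi + H"
        using bodies[OF _ K(1)] c1 by blast
      have K2: "convex_body K2 \<and> centrally_symmetric K2 \<and> intrinsic_volume 0 K2 = 1 \<and> intrinsic_volume 3 K2 = A * H \<and>
          intrinsic_volume 2 K2 = A + pi * H \<and> intrinsic_volume 1 K2 = pi + H"
        using bodies[OF _ K(2)] c2 by blast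
      have "intrinsic_volume j K1 = intrinsic_volume j K2" if "j \<le> 3" for j
      proof -
        have "j = 0 \<or> j = 1 \<or> j = 2 \<or> j = 3" using that by linarith
        then show ?thesis using K1 K2 by auto
      qed
      then show "?concl K1 K2 A'"
        using K1 K2 width_gap[OF c1 c2] brightness_gap[OF c1 c2] pos unfolding A' K by blast
    qed
    show "\<not> (\<forall>K L :: (real^3) set.
         convex_body K \<and> centrally_symmetric K \<and> convex_body L \<and> centrally_symmetric L \<and>
         (\<forall>j\<in>{1, 2, 3}. intrinsic_volume j K = intrinsic_volume j L) \<longrightarrow>
         width_law K = width_law L)"
    proof
      assume "\<forall>K L :: (real^3) set.
         convex_body K \<and> centrally_symmetric K \<and> convex_body L \<and> centrally_symmetric L \<and>
         (\<forall>j\<in>{1, 2, 3}. intrinsic_volume j K = intrinsic_volume j L) \<longrightarrow>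
         width_law K = width_law L"
      from this[THEN spec, of "prism P1 H", THEN spec, of "prism P2 H"]
      show False using witnesses width_laws by satx
    qed
    show "\<not> (\<forall>K L :: (real^3) set.
         convex_body K \<and> centrally_symmetric K \<and> convex_body L \<and> centrally_symmetric L \<and>
         (\<forall>j\<in>{1, 2, 3}. intrinsic_volume j K = intrinsic_volume j L) \<longrightarrow>
         brightness_law K = brightness_law L)"
    proof
      assume "\<forall>K L :: (real^3) set.
         convex_body K \<and> centrally_symmetric K \<and> convex_body L \<and> centrally_symmetric L \<and>
         (\<forall>j\<in>{1, 2, 3}. intrinsic_volume j K = intrinsic_volume j L) \<longrightarrow>
         brightness_law K = brightness_law L"
      from this[THEN spec, of "prism P1 H", THEN spec, of "prism P2 H"]
      show False using witnesses brightness_laws by satx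
    qed
  qed (rule ex1 ex2)+
qed

end
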